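(* Let $0<\varepsilon,\delta\ll1$ and let $\omega\in\mathbb R\setminus\{0\}$ be such that $|\omega\varepsilon|\ll1$. Assume that the system (E) of the context has a non-trivial solution of the form $$\begin{pmatrix} u \\ p \\ \rho \end{pmatrix}=\exp\big(i(\omega t+\xi_x x+\xi_y y)-\lambda z\big)\,\mathsf U,$$ with $\mathsf U\in\mathbb C^5\setminus\{0\}$, $\xi=(\xi_x,\xi_y)\in\mathbb R^2$ with $|\xi|\ll|\omega/\nu_{\mathrm{eff}}|^{1/2}$, and $\Re(\lambda)>0$, $\Re(\lambda)\gg1$. Then $$\text{either}\quad\lambda\sim e^{-i\frac\pi4\operatorname{sgn}(\omega)}\frac{|\tan\alpha|}{\nu_{\mathrm{eff}}^{1/2}\,\varepsilon\,|\omega|^{1/2}}\qquad\text{or}\qquad\lambda\sim e^{i\frac\pi4\operatorname{sgn}(\omega)}\frac{|\omega|^{1/2}}{\nu_{\mathrm{eff}}^{1/2}|\sin\alpha|}.$$ Denote by $\widetilde{\mathsf U}$ the vector of the first three components (the velocity) of $\mathsf U$. 1. In the first case, $\widetilde{\mathsf U}\simeq e_x$ (after normalization). In this case, the hydrostatic balance ($\partial_3 p\simeq-\rho$) is satisfied at main order, and the viscous dissipation is balanced by rotation (the Coriolis term) in the $e_y$ direction. 2. In the second case, $\widetilde{\mathsf U}\simeq e_y$ (after normalization). In this case, the hydrostatic balance ($\partial_3 p\simeq-\rho$) and the quasi-geostrophic balance ($u_h^\perp\simeq-\nabla_h p$) are satisfied at main order.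
   Context: $\alpha\in(-\pi/2,\pi/2)$ with $\sin\alpha\neq0$ is fixed, and $\Omega=\{(x_1,x_2,x_3)\in\mathbb R^3:\ x_3>x_1\tan\alpha\}$. Local coordinates $(x,y,z)$ are associated with $e_x=\cos\alpha\,e_1+\sin\alpha\,e_3$, $e_y=e_2$, $e_z=-\sin\alpha\,e_1+\cos\alpha\,e_3$, so $\Omega=\{z>0\}$. Write $u_h=(u_1,u_2)$, $u_h^\perp=(-u_2,u_1)$, $\nabla_h=(\partial_1,\partial_2)$, $\Delta_h=\partial_1^2+\partial_2^2$, $\nu_h,\nu_3>0$, and $\nu_{\mathrm{eff}}=\nu_h\sin^2\alpha+\nu_3\cos^2\alpha$. System (E) (no boundary condition imposed): $$\partial_t u+\tfrac1\varepsilon e_3\wedge u+\tfrac1\varepsilon\begin{pmatrix} \nabla_h p \\ \delta^{-2}\partial_3 p \end{pmatrix}-\nu_h\Delta_h u-\nu_3\partial_3^2 u=\tfrac1{\varepsilon\delta^2}\begin{pmatrix} 0 \\ 0 \\ -\rho \end{pmatrix},\qquad\partial_t\rho-\tfrac1\varepsilon u_3=0,\qquad\operatorname{div}u=0\qquad\text{in }\Omega.$$ Asymptotic notation refers to families of parameters in the stated regime: $A\ll B$ means $A/B\to0$, $A\sim B$ means $A/B\to1$, and $\simeq$ means equality at main order. "Balanced by rotation in the $e_y$ direction" means that in the $e_y$ component of the momentum equation the viscous term and the Coriolis term cancel at main order and the other terms are of lower order.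
   Formalization: Added hypothesis: λ/|ξ| does not accumulate at 1 (automatic if ξ is bounded or |ξ|≪Re λ). It excludes a third mode λ∼|ξ|, possible for unbounded ξ, for which the claim fails. "Either/or" means the parameter family splits into two parts, one for each case. *)

theory Defs
  imports "HOL-Analysis.Analysis" "HOL-Library.Landau_Symbols"
begin

section \<open>Geometry\<close>

definition Omega :: "real \<Rightarrow> (real^3) set" where
  "Omega \<alpha> = {x. x $ 3 > x $ 1 * tan \<alpha>}"

definition e_x :: "real \<Rightarrow> real^3" where
  "e_x \<alpha> = vector [cos \<alpha>, 0, sin \<alpha>]"

definition e_y :: "real^3" where
  "e_y = vector [0, 1, 0]"

definition e_z :: "real \<Rightarrow> real^3" where
  "e_z \<alpha> = vector [- sin \<alpha>, 0, cos \<alpha>]"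

definition cvec :: "real^3 \<Rightarrow> complex^3" where
  "cvec v = (\<chi> j. complex_of_real (v $ j))"

definition nu_eff :: "real \<Rightarrow> real \<Rightarrow> real \<Rightarrow> real" where
  "nu_eff \<alpha> \<nu>h \<nu>3 = \<nu>h * (sin \<alpha>)\<^sup>2 + \<nu>3 * (cos \<alpha>)\<^sup>2"


section \<open>The system (E)\<close>

text \<open>Fields depend on time and on the Cartesian coordinates \<open>x\<close>; velocities are written in the
  Cartesian basis \<open>e\<^sub>1, e\<^sub>2, e\<^sub>3\<close>. All fields are complex valued because the waves are.\<close>

definition partial :: "3 \<Rightarrow> (real^3 \<Rightarrow> 'a::real_normed_vector) \<Rightarrow> real^3 \<Rightarrow> 'a" where
  "partial j f x = vector_derivative (\<lambda>s. f (x + s *\<^sub>R axis j 1)) (at 0)"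

definition dt :: "(real \<Rightarrow> real^3 \<Rightarrow> 'a::real_normed_vector) \<Rightarrow> real \<Rightarrow> real^3 \<Rightarrow> 'a" where
  "dt f t x = vector_derivative (\<lambda>s. f s x) (at t)"

definition coriolis_term :: "real \<Rightarrow> complex^3 \<Rightarrow> complex^3" where
  "coriolis_term \<epsilon> v = (1 / \<epsilon>) *\<^sub>R vector [- v $ 2, v $ 1, 0]"

definition pressure_term :: "real \<Rightarrow> real \<Rightarrow> (real^3 \<Rightarrow> complex) \<Rightarrow> real^3 \<Rightarrow> complex^3" where
  "pressure_term \<epsilon> \<delta> p x =
     (1 / \<epsilon>) *\<^sub>R vector [partial 1 p x, partial 2 p x, (1 / \<delta>\<^sup>2) *\<^sub>R partial 3 p x]"

definition viscous_term :: "real \<Rightarrow> real \<Rightarrow> (real^3 \<Rightarrow> complex^3) \<Rightarrow> real^3 \<Rightarrow> complex^3" where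
  "viscous_term \<nu>h \<nu>3 v x =
     - (\<nu>h *\<^sub>R (partial 1 (partial 1 v) x + partial 2 (partial 2 v) x))
     - \<nu>3 *\<^sub>R partial 3 (partial 3 v) x"

definition buoyancy_term :: "real \<Rightarrow> real \<Rightarrow> complex \<Rightarrow> complex^3" where
  "buoyancy_term \<epsilon> \<delta> r = (1 / (\<epsilon> * \<delta>\<^sup>2)) *\<^sub>R vector [0, 0, - r]"

definition divergence :: "(real^3 \<Rightarrow> complex^3) \<Rightarrow> real^3 \<Rightarrow> complex" where
  "divergence v x = (\<Sum>j\<in>UNIV. partial j (\<lambda>y. v y $ j) x)"

text \<open>The differentiability requirements make every derivative in the equations a genuine one
  rather than the unspecified value of \<^const>\<open>vector_derivative\<close> at a bad point.\<close>

definition solves_E ::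
  "real \<Rightarrow> real \<Rightarrow> real \<Rightarrow> real \<Rightarrow> real \<Rightarrow>
   (real \<Rightarrow> real^3 \<Rightarrow> complex^3) \<Rightarrow> (real \<Rightarrow> real^3 \<Rightarrow> complex) \<Rightarrow> (real \<Rightarrow> real^3 \<Rightarrow> complex) \<Rightarrow> bool"
  where
  "solves_E \<alpha> \<epsilon> \<delta> \<nu>h \<nu>3 u p \<rho> \<longleftrightarrow>
     (\<forall>t. \<forall>x\<in>Omega \<alpha>.
        (\<lambda>s. u s x) differentiable (at t) \<and> (\<lambda>s. \<rho> s x) differentiable (at t) \<and>
        u t differentiable (at x) \<and> p t differentiable (at x) \<and>
        (\<forall>j. partial j (u t) differentiable (at x)) \<and>
        dt u t x + coriolis_term \<epsilon> (u t x) + pressure_term \<epsilon> \<delta> (p t) x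
          + viscous_term \<nu>h \<nu>3 (u t) x = buoyancy_term \<epsilon> \<delta> (\<rho> t x) \<and>
        dt \<rho> t x - (1 / \<epsilon>) *\<^sub>R u t x $ 3 = 0 \<and>
        divergence (u t) x = 0)"


section \<open>Wave solutions\<close>

definition plane_wave :: "real \<Rightarrow> real \<Rightarrow> real^2 \<Rightarrow> complex \<Rightarrow> real \<Rightarrow> real^3 \<Rightarrow> complex" where
  "plane_wave \<alpha> \<omega> \<xi> l t x =
     exp (\<i> * complex_of_real (\<omega> * t + \<xi> $ 1 * (x \<bullet> e_x \<alpha>) + \<xi> $ 2 * (x \<bullet> e_y))
          - l * complex_of_real (x \<bullet> e_z \<alpha>))"

definition velocity_part :: "complex^5 \<Rightarrow> complex^3" where
  "velocity_part U = vector [U $ 1, U $ 2, U $ 3]"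

definition wave_u ::
  "real \<Rightarrow> real \<Rightarrow> real^2 \<Rightarrow> complex \<Rightarrow> complex^5 \<Rightarrow> real \<Rightarrow> real^3 \<Rightarrow> complex^3" where
  "wave_u \<alpha> \<omega> \<xi> l U t x = plane_wave \<alpha> \<omega> \<xi> l t x *s velocity_part U"

definition wave_p ::
  "real \<Rightarrow> real \<Rightarrow> real^2 \<Rightarrow> complex \<Rightarrow> complex^5 \<Rightarrow> real \<Rightarrow> real^3 \<Rightarrow> complex" where
  "wave_p \<alpha> \<omega> \<xi> l U t x = plane_wave \<alpha> \<omega> \<xi> l t x * U $ 4"

definition wave_rho ::
  "real \<Rightarrow> real \<Rightarrow> real^2 \<Rightarrow> complex \<Rightarrow> complex^5 \<Rightarrow> real \<Rightarrow> real^3 \<Rightarrow> complex" where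
  "wave_rho \<alpha> \<omega> \<xi> l U t x = plane_wave \<alpha> \<omega> \<xi> l t x * U $ 5"

definition rate1 :: "real \<Rightarrow> real \<Rightarrow> real \<Rightarrow> real \<Rightarrow> real \<Rightarrow> complex" where
  "rate1 \<alpha> \<epsilon> \<nu>h \<nu>3 \<omega> =
     exp (- \<i> * complex_of_real (pi / 4 * sgn \<omega>))
     * complex_of_real (\<bar>tan \<alpha>\<bar> / (sqrt (nu_eff \<alpha> \<nu>h \<nu>3) * \<epsilon> * sqrt \<bar>\<omega>\<bar>))"

definition rate2 :: "real \<Rightarrow> real \<Rightarrow> real \<Rightarrow> real \<Rightarrow> complex" where
  "rate2 \<alpha> \<nu>h \<nu>3 \<omega> =
     exp (\<i> * complex_of_real (pi / 4 * sgn \<omega>))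
     * complex_of_real (sqrt \<bar>\<omega>\<bar> / (sqrt (nu_eff \<alpha> \<nu>h \<nu>3) * \<bar>sin \<alpha>\<bar>))"


section \<open>Statements at main order\<close>

text \<open>A family of parameters is indexed by a type \<open>'i\<close> and the limit is taken along a filter on it.
  The balances below are required at every time and every point of the domain, both of which may
  vary with the index. Vector quantities are compared in norm.\<close>

definition aligned_with :: "'i filter \<Rightarrow> ('i \<Rightarrow> complex^3) \<Rightarrow> complex^3 \<Rightarrow> bool" where
  "aligned_with F V e \<longleftrightarrow>
     (\<exists>c :: 'i \<Rightarrow> complex. (\<forall>i. c i \<noteq> 0) \<and> ((\<lambda>i. c i *s V i) \<longlongrightarrow> e) F)"

definition hydrostatic_balance ::
  "real \<Rightarrow> 'i filter \<Rightarrow> ('i \<Rightarrow> real \<Rightarrow> real^3 \<Rightarrow> complex) \<Rightarrow>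
   ('i \<Rightarrow> real \<Rightarrow> real^3 \<Rightarrow> complex) \<Rightarrow> bool" where
  "hydrostatic_balance \<alpha> F p \<rho> \<longleftrightarrow>
     (\<forall>t x. (\<forall>i. x i \<in> Omega \<alpha>) \<longrightarrow>
        (\<lambda>i. partial 3 (p i (t i)) (x i)) \<sim>[F] (\<lambda>i. - \<rho> i (t i) (x i)))"

definition quasi_geostrophic_balance ::
  "real \<Rightarrow> 'i filter \<Rightarrow> ('i \<Rightarrow> real \<Rightarrow> real^3 \<Rightarrow> complex^3) \<Rightarrow>
   ('i \<Rightarrow> real \<Rightarrow> real^3 \<Rightarrow> complex) \<Rightarrow> bool" where
  "quasi_geostrophic_balance \<alpha> F u p \<longleftrightarrow>
     (\<forall>t x. (\<forall>i. x i \<in> Omega \<alpha>) \<longrightarrow>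
        (let uperp = \<lambda>i. vector [- u i (t i) (x i) $ 2, u i (t i) (x i) $ 1] :: complex^2;
             gradh = \<lambda>i. vector [partial 1 (p i (t i)) (x i), partial 2 (p i (t i)) (x i)] :: complex^2
         in (\<lambda>i. norm (uperp i - (- gradh i))) \<in> o[F](\<lambda>i. norm (gradh i))))"

text \<open>The buoyancy term has no \<open>e\<^sub>y\<close> component, so time derivative and pressure are the only
  other terms in that component. Since \<open>e\<^sub>y = e\<^sub>2\<close>, it is the second Cartesian component.\<close>

definition rotation_balances_viscosity_y ::
  "real \<Rightarrow> 'i filter \<Rightarrow> ('i \<Rightarrow> real) \<Rightarrow> ('i \<Rightarrow> real) \<Rightarrow> ('i \<Rightarrow> real) \<Rightarrow> ('i \<Rightarrow> real) \<Rightarrow>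
   ('i \<Rightarrow> real \<Rightarrow> real^3 \<Rightarrow> complex^3) \<Rightarrow> ('i \<Rightarrow> real \<Rightarrow> real^3 \<Rightarrow> complex) \<Rightarrow> bool" where
  "rotation_balances_viscosity_y \<alpha> F \<epsilon> \<delta> \<nu>h \<nu>3 u p \<longleftrightarrow>
     (\<forall>t x. (\<forall>i. x i \<in> Omega \<alpha>) \<longrightarrow>
        (let C = \<lambda>i. coriolis_term (\<epsilon> i) (u i (t i) (x i)) $ 2 in
           (\<lambda>i. viscous_term (\<nu>h i) (\<nu>3 i) (u i (t i)) (x i) $ 2) \<sim>[F] (\<lambda>i. - C i) \<and>
           (\<lambda>i. dt (u i) (t i) (x i) $ 2) \<in> o[F](C) \<and>
           (\<lambda>i. pressure_term (\<epsilon> i) (\<delta> i) (p i (t i)) (x i) $ 2) \<in> o[F](C)))"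


section \<open>The inviscid mode\<close>

text \<open>If \<open>|\<xi>|\<close> is unbounded (which \<open>|\<xi>| \<lless> |\<omega> / \<nu>\<^sub>e\<^sub>f\<^sub>f|\<^sup>1\<^sup>/\<^sup>2\<close> allows when that quantity is), (E) has a
  third decaying mode, with \<open>l \<sim> |\<xi>|\<close> and a main-order harmonic pressure: it satisfies
  \<open>Re l \<rightarrow> \<infinity>\<close> but has neither of the two rates. The predicate says that \<open>l / |\<xi>|\<close> does not accumulate
  at 1. For bounded \<open>\<xi>\<close>, or more generally for \<open>|\<xi>| \<lless> Re l\<close>, it is automatic.\<close>

definition avoids_inviscid_mode :: "'i filter \<Rightarrow> ('i \<Rightarrow> real^2) \<Rightarrow> ('i \<Rightarrow> complex) \<Rightarrow> bool" where
  "avoids_inviscid_mode F \<xi> l \<longleftrightarrow>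
     (\<exists>c>0. \<forall>\<^sub>F i in F. c * norm (\<xi> i) \<le> cmod (l i - complex_of_real (norm (\<xi> i))))"

lemma avoids_inviscid_mode_if_smallo:
  assumes "(\<lambda>i. norm (\<xi> i)) \<in> o[F](\<lambda>i. Re (l i))" "\<forall>\<^sub>F i in F. Re (l i) > 0"
  shows "avoids_inviscid_mode F \<xi> l"
proof -
  have "\<forall>\<^sub>F i in F. norm (norm (\<xi> i)) \<le> 1/2 * norm (Re (l i))"
    using landau_o.smallD[OF assms(1), of "1/2"] by simp
  with assms(2) have "\<forall>\<^sub>F i in F. 1 * norm (\<xi> i) \<le> cmod (l i - complex_of_real (norm (\<xi> i)))"
  proof eventually_elim
    case (elim i)
    have "Re (l i) - norm (\<xi> i) \<le> cmod (l i - complex_of_real (norm (\<xi> i)))"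
      using complex_Re_le_cmod[of "l i - complex_of_real (norm (\<xi> i))"] by simp
    with elim show ?case by simp
  qed
  then show ?thesis
    unfolding avoids_inviscid_mode_def by (intro exI[of _ 1]) simp
qed

lemma avoids_inviscid_mode_if_bounded:
  assumes "\<forall>\<^sub>F i in F. norm (\<xi> i) \<le> K" "filterlim (\<lambda>i. Re (l i)) at_top F"
  shows "avoids_inviscid_mode F \<xi> l"
proof -
  have "\<forall>\<^sub>F i in F. Re (l i) \<ge> 2 * K"
    using assms(2) by (simp add: filterlim_at_top)
  with assms(1) have "\<forall>\<^sub>F i in F. 1 * norm (\<xi> i) \<le> cmod (l i - complex_of_real (norm (\<xi> i)))"
  proof eventually_elim
    case (elim i)
    have "Re (l i) - norm (\<xi> i) \<le> cmod (l i - complex_of_real (norm (\<xi> i)))"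
      using complex_Re_le_cmod[of "l i - complex_of_real (norm (\<xi> i))"] by simp
    with elim show ?case by simp
  qed
  then show ?thesis
    unfolding avoids_inviscid_mode_def by (intro exI[of _ 1]) simp
qed

end

theory Submission
  imports Defs
begin

text \<open>
  Let \<open>k\<close> be the complex wave vector and write \<open>s = \<i>\<omega>\<epsilon>\<close>, \<open>m = \<epsilon>(\<i>\<omega> - \<nu>\<^sub>h(k\<^sub>1\<^sup>2 + k\<^sub>2\<^sup>2) - \<nu>\<^sub>3k\<^sub>3\<^sup>2)\<close>.
  Eliminating the amplitudes from (E) gives the dispersion relation
  \<open>m(k\<^sub>1\<^sup>2 + k\<^sub>2\<^sup>2)(1 + s\<delta>\<^sup>2m) + s k\<^sub>3\<^sup>2(1 + m\<^sup>2) = 0\<close>. If \<open>l\<close> were at most of the order of \<open>\<xi>\<close>, viscosity would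
  be negligible, \<open>m \<sim> s\<close>, and the relation would reduce to \<open>k\<^sub>1\<^sup>2 + k\<^sub>2\<^sup>2 + k\<^sub>3\<^sup>2 = l\<^sup>2 - |\<xi>|\<^sup>2 \<simeq> 0\<close>, the inviscid
  mode. Hence \<open>\<xi>\<close> is negligible against \<open>l\<close>, so \<open>k \<simeq> l(sin \<alpha>, 0, - cos \<alpha>)\<close>, and the relation becomes
  quadratic in \<open>m\<close> with one small root \<open>m \<sim> - s cot\<^sup>2 \<alpha>\<close> and one large root \<open>m \<sim> - tan\<^sup>2 \<alpha> / s\<close>. Since
  \<open>m \<simeq> s - \<epsilon> \<nu>\<^sub>e\<^sub>f\<^sub>f l\<^sup>2\<close>, each root determines \<open>l\<^sup>2\<close>, and \<open>Re l > 0\<close> selects the square root.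
\<close>

section \<open>Plane waves and the dispersion relation\<close>

text \<open>The factor \<open>\<i>\<close> is absorbed into the wave vector, so a Cartesian
  derivative of the plane wave is multiplication by a component of it.\<close>

definition wave_vec :: "real \<Rightarrow> real^2 \<Rightarrow> complex \<Rightarrow> complex^3" where
  "wave_vec \<alpha> \<xi> l = (\<i> * \<xi> $ 1) *s cvec (e_x \<alpha>) + (\<i> * \<xi> $ 2) *s cvec e_y - l *s cvec (e_z \<alpha>)"

lemma wave_vec_nth:
  "wave_vec \<alpha> \<xi> l $ 1 = \<i> * \<xi> $ 1 * cos \<alpha> + l * sin \<alpha>"
  "wave_vec \<alpha> \<xi> l $ 2 = \<i> * \<xi> $ 2"
  "wave_vec \<alpha> \<xi> l $ 3 = \<i> * \<xi> $ 1 * sin \<alpha> - l * cos \<alpha>"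
  by (simp_all add: wave_vec_def cvec_def e_x_def e_y_def e_z_def vector_3)

lemma plane_wave_shift:
  "plane_wave \<alpha> \<omega> \<xi> l t (x + r *\<^sub>R axis j 1)
     = exp (of_real r * wave_vec \<alpha> \<xi> l $ j) * plane_wave \<alpha> \<omega> \<xi> l t x"
proof -
  have "axis j 1 \<bullet> v = v $ j" for v :: "real^3"
    by (simp add: inner_axis')
  then show ?thesis
    by (simp add: plane_wave_def wave_vec_def cvec_def algebra_simps flip: exp_add)
qed

lemma plane_wave_nonzero: "plane_wave \<alpha> \<omega> \<xi> l t x \<noteq> 0"
  by (simp add: plane_wave_def)

text \<open>The linear map \<open>f\<close> lets one computation serve the pressure, the velocity
  and its components. Equality of functions, not only at a point, makes a second differentiation
  possible.\<close>

lemma partial_plane_wave: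
  assumes "bounded_linear f"
  shows "partial j (\<lambda>y. f (plane_wave \<alpha> \<omega> \<xi> l t y)) =
     (\<lambda>x. f (wave_vec \<alpha> \<xi> l $ j * plane_wave \<alpha> \<omega> \<xi> l t x))"
proof
  fix x
  let ?k = "wave_vec \<alpha> \<xi> l $ j"
  have "((\<lambda>r. exp (of_real r * ?k) * plane_wave \<alpha> \<omega> \<xi> l t x) has_vector_derivative
          ?k * plane_wave \<alpha> \<omega> \<xi> l t x) (at 0)"
    by (auto intro!: derivative_eq_intros has_vector_derivative_real_field)
  from bounded_linear.has_vector_derivative[OF assms this]
  show "partial j (\<lambda>y. f (plane_wave \<alpha> \<omega> \<xi> l t y)) x = f (?k * plane_wave \<alpha> \<omega> \<xi> l t x)"
    by (simp add: partial_def plane_wave_shift vector_derivative_at)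
qed

lemma dt_plane_wave:
  assumes "bounded_linear f"
  shows "dt (\<lambda>t x. f (plane_wave \<alpha> \<omega> \<xi> l t x)) t x = f (\<i> * \<omega> * plane_wave \<alpha> \<omega> \<xi> l t x)"
proof -
  have "((\<lambda>t. plane_wave \<alpha> \<omega> \<xi> l t x) has_vector_derivative
          \<i> * \<omega> * plane_wave \<alpha> \<omega> \<xi> l t x) (at t)"
    unfolding plane_wave_def
    by (auto intro!: derivative_eq_intros has_vector_derivative_real_field)
  from bounded_linear.has_vector_derivative[OF assms this] show ?thesis
    by (simp add: dt_def vector_derivative_at)
qed

lemma bounded_linear_vector_scale_left: "bounded_linear (\<lambda>c::complex. c *s (V::complex^'n))"
  unfolding linear_conv_bounded_linear[symmetric]
  by (rule linearI) (auto simp: vec_eq_iff algebra_simps)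

definition viscous_symbol :: "real \<Rightarrow> real \<Rightarrow> complex^3 \<Rightarrow> complex" where
  "viscous_symbol \<nu>h \<nu>3 k = \<nu>h * ((k $ 1)\<^sup>2 + (k $ 2)\<^sup>2) + \<nu>3 * (k $ 3)\<^sup>2"

lemma dt_wave:
  "dt (wave_u \<alpha> \<omega> \<xi> l U) t x = (\<i> * \<omega>) *s wave_u \<alpha> \<omega> \<xi> l U t x"
  "dt (wave_rho \<alpha> \<omega> \<xi> l U) t x = \<i> * \<omega> * wave_rho \<alpha> \<omega> \<xi> l U t x"
  using dt_plane_wave[OF bounded_linear_vector_scale_left, of \<alpha> \<omega> \<xi> l "velocity_part U" t x]
    dt_plane_wave[OF bounded_linear_mult_left, of \<alpha> \<omega> \<xi> l "U $ 5" t x]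
  by (simp_all add: wave_u_def[abs_def] wave_rho_def[abs_def])

lemma partial_wave_p:
  "partial j (wave_p \<alpha> \<omega> \<xi> l U t) x = wave_vec \<alpha> \<xi> l $ j * wave_p \<alpha> \<omega> \<xi> l U t x"
  using partial_plane_wave[OF bounded_linear_mult_left, of j \<alpha> \<omega> \<xi> l t "U $ 4"]
  by (simp add: wave_p_def[abs_def])

lemma viscous_term_wave:
  "viscous_term \<nu>h \<nu>3 (wave_u \<alpha> \<omega> \<xi> l U t) x =
     - viscous_symbol \<nu>h \<nu>3 (wave_vec \<alpha> \<xi> l) *s wave_u \<alpha> \<omega> \<xi> l U t x"
proof -
  let ?k = "wave_vec \<alpha> \<xi> l"
  have "partial j (partial j (wave_u \<alpha> \<omega> \<xi> l U t)) x = (?k $ j)\<^sup>2 *s wave_u \<alpha> \<omega> \<xi> l U t x" for j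
  proof -
    have 1: "partial j (wave_u \<alpha> \<omega> \<xi> l U t)
        = (\<lambda>x. (?k $ j * plane_wave \<alpha> \<omega> \<xi> l t x) *s velocity_part U)"
      unfolding wave_u_def[abs_def]
      by (rule partial_plane_wave[OF bounded_linear_vector_scale_left])
    have bl: "bounded_linear (\<lambda>c. (?k $ j * c) *s velocity_part U)"
      by (rule bounded_linear_compose[OF bounded_linear_vector_scale_left bounded_linear_mult_right])
    show ?thesis
      unfolding 1 partial_plane_wave[OF bl] by (simp add: wave_u_def power2_eq_square mult.assoc)
  qed
  then show ?thesis
    by (simp add: viscous_term_def viscous_symbol_def vec_eq_iff scaleR_conv_of_real[of _ "_::complex"] algebra_simps)
qed

lemma divergence_wave:
  "divergence (wave_u \<alpha> \<omega> \<xi> l U t) x =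
     (\<Sum>j\<in>UNIV. wave_vec \<alpha> \<xi> l $ j * wave_u \<alpha> \<omega> \<xi> l U t x $ j)"
proof -
  have "partial j (\<lambda>y. wave_u \<alpha> \<omega> \<xi> l U t y $ j) x
      = wave_vec \<alpha> \<xi> l $ j * wave_u \<alpha> \<omega> \<xi> l U t x $ j" for j
    using partial_plane_wave[OF bounded_linear_mult_left, of j \<alpha> \<omega> \<xi> l t "velocity_part U $ j"]
    by (simp add: wave_u_def[abs_def])
  then show ?thesis by (simp add: divergence_def)
qed

text \<open>Time derivative and viscosity act on the velocity as one scalar; the factor
  \<open>\<epsilon>\<close> normalizes the Coriolis coefficient to 1.\<close>

definition momentum_symbol :: "real \<Rightarrow> real \<Rightarrow> real \<Rightarrow> real \<Rightarrow> complex^3 \<Rightarrow> complex" where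
  "momentum_symbol \<epsilon> \<nu>h \<nu>3 \<omega> k = \<epsilon> * (\<i> * \<omega> - viscous_symbol \<nu>h \<nu>3 k)"

text \<open>All fields are constant amplitudes times one nonvanishing exponential, so it suffices to
  evaluate at a single time and point and cancel. The momentum rows are scaled by
  \<open>\<epsilon>\<close>, \<open>\<epsilon>\<close> and
  \<open>\<epsilon> * \<delta>^2\<close>.\<close>

lemma amplitude_equations:
  assumes "solves_E \<alpha> \<epsilon> \<delta> \<nu>h \<nu>3 (wave_u \<alpha> \<omega> \<xi> l U) (wave_p \<alpha> \<omega> \<xi> l U) (wave_rho \<alpha> \<omega> \<xi> l U)"
    and "\<epsilon> > 0" "\<delta> > 0"
  defines "k \<equiv> wave_vec \<alpha> \<xi> l"
  defines "m \<equiv> momentum_symbol \<epsilon> \<nu>h \<nu>3 \<omega> k"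
  shows "m * U $ 1 - U $ 2 + k $ 1 * U $ 4 = 0"
    and "m * U $ 2 + U $ 1 + k $ 2 * U $ 4 = 0"
    and "complex_of_real (\<delta>\<^sup>2) * m * U $ 3 + k $ 3 * U $ 4 + U $ 5 = 0"
    and "\<i> * \<omega> * \<epsilon> * U $ 5 = U $ 3"
    and "k $ 1 * U $ 1 + k $ 2 * U $ 2 + k $ 3 * U $ 3 = 0"
proof -
  \<comment> \<open>This point lies in the domain for every \<open>\<alpha>\<close>: its first
    coordinate is 0 and its third is 1.\<close>
  define x :: "real^3" where "x = axis 3 1"
  define E where "E = plane_wave \<alpha> \<omega> \<xi> l 0 x"
  have E: "E \<noteq> 0" by (simp add: E_def plane_wave_nonzero)
  have "x \<in> Omega \<alpha>" by (simp add: x_def Omega_def axis_def)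
  with assms(1) have eqs:
    "dt (wave_u \<alpha> \<omega> \<xi> l U) 0 x + coriolis_term \<epsilon> (wave_u \<alpha> \<omega> \<xi> l U 0 x)
       + pressure_term \<epsilon> \<delta> (wave_p \<alpha> \<omega> \<xi> l U 0) x
       + viscous_term \<nu>h \<nu>3 (wave_u \<alpha> \<omega> \<xi> l U 0) x = buoyancy_term \<epsilon> \<delta> (wave_rho \<alpha> \<omega> \<xi> l U 0 x)"
    "dt (wave_rho \<alpha> \<omega> \<xi> l U) 0 x - (1 / \<epsilon>) *\<^sub>R wave_u \<alpha> \<omega> \<xi> l U 0 x $ 3 = 0"
    "divergence (wave_u \<alpha> \<omega> \<xi> l U 0) x = 0"
    unfolding solves_E_def by blast+
  note defs = dt_wave coriolis_term_def pressure_term_def buoyancy_term_def viscous_term_wave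
    divergence_wave partial_wave_p wave_u_def wave_p_def wave_rho_def velocity_part_def
    momentum_symbol_def scaleR_conv_of_real[of _ "_::complex"] sum_3
  have c: "complex_of_real \<epsilon> \<noteq> 0" "complex_of_real \<delta> \<noteq> 0" using assms(2,3) by auto
  have "E * m * U $ 1 - E * U $ 2 + E * k $ 1 * U $ 4 = 0"
    using arg_cong[OF eqs(1), of "\<lambda>v. v $ 1"] c
    by (simp add: defs m_def flip: E_def k_def) (simp add: field_simps)
  then show "m * U $ 1 - U $ 2 + k $ 1 * U $ 4 = 0" using E by algebra
  have "E * m * U $ 2 + E * U $ 1 + E * k $ 2 * U $ 4 = 0"
    using arg_cong[OF eqs(1), of "\<lambda>v. v $ 2"] c
    by (simp add: defs m_def flip: E_def k_def) (simp add: field_simps)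
  then show "m * U $ 2 + U $ 1 + k $ 2 * U $ 4 = 0" using E by algebra
  \<comment> \<open>Clearing denominators leaves the nonzero factor
    \<open>\<epsilon> * \<delta>^2 * E\<close>, which is split off next.\<close>
  have "\<epsilon> * \<delta>\<^sup>2 * E * \<delta>\<^sup>2 * m * U $ 3 + \<epsilon> * \<delta>\<^sup>2 * E * k $ 3 * U $ 4 + \<epsilon> * \<delta>\<^sup>2 * E * U $ 5 = 0"
    using arg_cong[OF eqs(1), of "\<lambda>v. v $ 3"] c
    by (simp add: defs m_def flip: E_def k_def) (simp add: field_simps)
  then have "(\<epsilon> * \<delta>\<^sup>2 * E) * (\<delta>\<^sup>2 * m * U $ 3 + k $ 3 * U $ 4 + U $ 5) = 0"
    by (simp only: of_real_mult of_real_power distrib_left mult.assoc)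
  then show "complex_of_real (\<delta>\<^sup>2) * m * U $ 3 + k $ 3 * U $ 4 + U $ 5 = 0" using E c by simp
  have "E * (\<i> * \<omega> * \<epsilon> * U $ 5) - E * U $ 3 = 0"
    using eqs(2) c by (simp add: defs flip: E_def k_def) (simp add: field_simps)
  then show "\<i> * \<omega> * \<epsilon> * U $ 5 = U $ 3" using E by algebra
  have "E * (k $ 1 * U $ 1 + k $ 2 * U $ 2 + k $ 3 * U $ 3) = 0"
    using eqs(3) by (simp add: defs algebra_simps flip: E_def k_def)
  then show "k $ 1 * U $ 1 + k $ 2 * U $ 2 + k $ 3 * U $ 3 = 0" using E by simp
qed

text \<open>Multiplying incompressibility by \<open>(1 + m^2) * (1 + s * d * m)\<close> and
  eliminating the velocity gives \<open>?D * p = 0\<close>. If \<open>?D\<close> were nonzero,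
  \<open>p\<close> would vanish, and the velocity with it; the last point needs care when one of the
  two multipliers is zero.\<close>

lemma dispersion_relation:
  fixes m s d k1 k2 k3 u1 u2 u3 p :: complex
  assumes e1: "m * u1 - u2 + k1 * p = 0"
    and e2: "m * u2 + u1 + k2 * p = 0"
    and e3: "(1 + s * d * m) * u3 = - s * k3 * p"
    and e4: "k1 * u1 + k2 * u2 + k3 * u3 = 0"
    and nontrivial: "\<not> (u1 = 0 \<and> u2 = 0 \<and> u3 = 0 \<and> p = 0)"
  shows "m * (k1\<^sup>2 + k2\<^sup>2) * (1 + s * d * m) + s * k3\<^sup>2 * (1 + m\<^sup>2) = 0" (is "?D = 0")
proof (rule ccontr)
  assume D: "?D \<noteq> 0"
  have u1: "(1 + m\<^sup>2) * u1 = - (m * k1 + k2) * p" using e1 e2 by algebra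
  have u2: "(1 + m\<^sup>2) * u2 = (k1 - m * k2) * p" using e1 e2 by algebra
  have "?D * p = 0" using u1 u2 e3 e4 by algebra
  with D have p: "p = 0" by simp
  have "(1 + m\<^sup>2) * u1 = 0" "(1 + m\<^sup>2) * u2 = 0" "(1 + s * d * m) * u3 = 0"
    using u1 u2 e3 p by simp_all
  then show False
  proof (cases "1 + m\<^sup>2 = 0")
    case True
    with D have k: "k1\<^sup>2 + k2\<^sup>2 \<noteq> 0" "1 + s * d * m \<noteq> 0" by auto
    have "u3 = 0" using e3 p k by simp
    \<comment> \<open>Here \<open>u2 = m * u1\<close>, so incompressibility reads
      \<open>(k1 + m * k2) * u1 = 0\<close>; multiply by \<open>k1 - m * k2\<close> and use
      \<open>m^2 = -1\<close>.\<close>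
    have "(k1\<^sup>2 + k2\<^sup>2) * u1 = 0" using True e1 e2 e4 p \<open>u3 = 0\<close> by algebra
    then show False using k e1 p nontrivial \<open>u3 = 0\<close> by simp
  next
    case False
    then have "u1 = 0" "u2 = 0" using u1 u2 p by auto
    then have u: "(1 + s * d * m) * u3 = 0" "k3 * u3 = 0" using e3 e4 p by simp_all
    \<comment> \<open>Each summand of \<open>?D\<close> has \<open>1 + s * d * m\<close> or
      \<open>k3\<close> as a factor, and both annihilate \<open>u3\<close>.\<close>
    then have "?D * u3 = 0" by algebra
    then show False using D nontrivial p \<open>u1 = 0\<close> \<open>u2 = 0\<close> by simp
  qed
qed

section \<open>Square roots and asymptotic equivalence\<close>

text \<open>In \<open>w^2 - 1 = (w - 1) * (w + 1)\<close> the second factor stays away from 0, which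
  excludes the root -1.\<close>

lemma tendsto_1_if_square:
  fixes w :: "'i \<Rightarrow> complex"
  assumes "((\<lambda>i. (w i)\<^sup>2) \<longlongrightarrow> 1) F" "r > 0" "\<forall>\<^sub>F i in F. r \<le> cmod (w i + 1)"
  shows "(w \<longlongrightarrow> 1) F"
proof -
  have "((\<lambda>i. (w i)\<^sup>2 - 1) \<longlongrightarrow> 0) F" using tendsto_diff[OF assms(1) tendsto_const[of 1]] by simp
  then have z: "((\<lambda>i. cmod ((w i)\<^sup>2 - 1) / r) \<longlongrightarrow> 0) F"
    using tendsto_divide_zero[OF tendsto_norm_zero] by blast
  have "\<forall>\<^sub>F i in F. cmod (w i - 1) \<le> cmod ((w i)\<^sup>2 - 1) / r"
    using assms(3)
  proof eventually_elim
    case (elim i)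
    have "(w i)\<^sup>2 - 1 = (w i - 1) * (w i + 1)" by algebra
    then have "cmod ((w i)\<^sup>2 - 1) = cmod (w i - 1) * cmod (w i + 1)" by (simp add: norm_mult)
    moreover have "cmod (w i - 1) * r \<le> cmod (w i - 1) * cmod (w i + 1)"
      by (rule mult_left_mono[OF elim]) simp
    ultimately show ?case using assms(2) by (simp add: field_simps)
  qed
  from Lim_null_comparison[OF this z] show ?thesis by (simp add: LIM_zero_iff)
qed

text \<open>Multiplying \<open>l / r + 1\<close> by the phase of \<open>r\<close> gives
  \<open>l / R + exp (\<i> * \<theta>)\<close>, whose real part exceeds \<open>cos (pi / 4)\<close>
  because \<open>Re l > 0\<close>. Both rates have argument plus or minus
  \<open>pi / 4\<close>.\<close>

lemma asymp_equiv_if_square: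
  fixes l :: "'i \<Rightarrow> complex" and \<theta> R :: "'i \<Rightarrow> real"
  assumes sq: "((\<lambda>i. (l i)\<^sup>2 / (r i)\<^sup>2) \<longlongrightarrow> 1) F"
    and r: "\<And>i. r i = exp (\<i> * \<theta> i) * R i" "\<And>i. R i > 0" "\<And>i. \<bar>\<theta> i\<bar> = pi / 4"
    and l: "\<And>i. Re (l i) > 0"
  shows "l \<sim>[F] r"
proof -
  have "cos (pi / 4) \<le> cmod (l i / r i + 1)" for i
  proof -
    have c: "cos (\<theta> i) = cos (pi / 4)" using r(3)[of i] by (metis cos_abs_real)
    have "exp (\<i> * \<theta> i) * (l i / r i + 1) = l i / R i + exp (\<i> * \<theta> i)"
      using r(2)[of i] by (simp add: r(1) field_simps)
    then have "cmod (l i / r i + 1) = cmod (l i / R i + exp (\<i> * \<theta> i))"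
      by (metis norm_mult norm_exp_i_times mult_1)
    also have "\<dots> \<ge> Re (l i / R i + exp (\<i> * \<theta> i))" by (rule complex_Re_le_cmod)
    also have "Re (l i / R i + exp (\<i> * \<theta> i)) = Re (l i) / R i + cos (pi / 4)"
      using c by (simp add: Re_exp)
    finally show ?thesis using l[of i] r(2)[of i]
      by (smt (verit) divide_pos_pos)
  qed
  then have "\<forall>\<^sub>F i in F. cos (pi / 4) \<le> cmod (l i / r i + 1)" by simp
  moreover have "cos (pi / 4) > (0::real)" by (simp add: cos_45)
  moreover have "((\<lambda>i. (l i / r i)\<^sup>2) \<longlongrightarrow> 1) F" using sq by (simp add: power_divide)
  ultimately have "((\<lambda>i. l i / r i) \<longlongrightarrow> 1) F"
    by (blast intro: tendsto_1_if_square)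
  then show ?thesis by (rule asymp_equivI')
qed

text \<open>Two turns by \<open>pi / 4 * sgn w\<close> give \<open>\<i> * sgn w\<close>. These are
  the squared phases of \<open>rate2\<close> and \<open>rate1\<close>.\<close>

lemma exp_quarter_turn_squared:
  assumes "w \<noteq> 0"
  shows "(exp (\<i> * complex_of_real (pi / 4 * sgn w)))\<^sup>2 * complex_of_real \<bar>w\<bar> = \<i> * w"
    and "(exp (- \<i> * complex_of_real (pi / 4 * sgn w)))\<^sup>2 * (\<i> * w) = complex_of_real \<bar>w\<bar>"
proof -
  have "(exp (\<i> * complex_of_real (pi / 4 * sgn w)))\<^sup>2 = \<i> * sgn w"
    using assms by (cases "w > 0") (auto simp: exp_Euler cis_conv_exp[symmetric] power2_eq_square
      complex_eq_iff Re_exp Im_exp cos_45 sin_45)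
  then show 1: "(exp (\<i> * complex_of_real (pi / 4 * sgn w)))\<^sup>2 * complex_of_real \<bar>w\<bar> = \<i> * w"
    by (simp add: mult_sgn_abs mult.assoc flip: of_real_mult)
  show "(exp (- \<i> * complex_of_real (pi / 4 * sgn w)))\<^sup>2 * (\<i> * w) = complex_of_real \<bar>w\<bar>"
    unfolding 1[symmetric] by (simp add: exp_minus field_simps)
qed

section \<open>Size of the wave vector and normalization of the velocity\<close>

lemma norm_complex_axis_combination:
  "cmod (\<i> * x * complex_of_real u + l * complex_of_real v) \<le> \<bar>x\<bar> * \<bar>u\<bar> + cmod l * \<bar>v\<bar>"
  by (rule order_trans[OF norm_triangle_ineq]) (simp add: norm_mult)

text \<open>The frame \<open>e_x\<close>, \<open>e_y\<close>, \<open>e_z\<close> is orthonormal, so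
  the bilinear square of the wave vector can be computed in local coordinates. It is the symbol of
  the full Laplacian and vanishes exactly for a harmonic wave.\<close>

lemma sum_wave_vec_squares:
  "(wave_vec \<alpha> \<xi> l $ 1)\<^sup>2 + (wave_vec \<alpha> \<xi> l $ 2)\<^sup>2 + (wave_vec \<alpha> \<xi> l $ 3)\<^sup>2
     = l\<^sup>2 - complex_of_real ((norm \<xi>)\<^sup>2)"
proof -
  have 1: "(complex_of_real (sin \<alpha>))\<^sup>2 + (complex_of_real (cos \<alpha>))\<^sup>2 = 1"
    by (metis of_real_1 of_real_add of_real_power sin_cos_squared_add)
  have 2: "complex_of_real ((norm \<xi>)\<^sup>2) = (complex_of_real (\<xi> $ 1))\<^sup>2 + (complex_of_real (\<xi> $ 2))\<^sup>2"
    by (simp only: power2_norm_eq_inner) (simp add: inner_vec_def sum_2 power2_eq_square)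
  have 3: "\<i>\<^sup>2 = -1" by simp
  show ?thesis unfolding 2 wave_vec_nth using 1 3 by algebra
qed

lemma norm_wave_vec_le: "cmod (wave_vec \<alpha> \<xi> l $ j) \<le> norm \<xi> + cmod l"
proof -
  have c: "\<bar>\<xi> $ 1\<bar> \<le> norm \<xi>" "\<bar>\<xi> $ 2\<bar> \<le> norm \<xi>"
    by (rule component_le_norm_cart)+
  have "cmod (\<i> * \<xi> $ 1 * complex_of_real x + l * complex_of_real y) \<le> norm \<xi> + cmod l"
    if "\<bar>x\<bar> \<le> 1" "\<bar>y\<bar> \<le> 1" for x y
  proof -
    have "\<bar>\<xi> $ 1\<bar> * \<bar>x\<bar> \<le> norm \<xi> * 1" "cmod l * \<bar>y\<bar> \<le> cmod l * 1"
      using c(1) that by (intro mult_mono; simp)+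
    then show ?thesis
      using norm_complex_axis_combination[of "\<xi> $ 1" x l y] by simp
  qed
  from this[of "cos \<alpha>" "sin \<alpha>"] this[of "sin \<alpha>" "- cos \<alpha>"] c(2)
  have "\<forall>j. cmod (wave_vec \<alpha> \<xi> l $ j) \<le> norm \<xi> + cmod l"
    unfolding forall_3 wave_vec_nth by (simp add: norm_mult add_increasing2)
  then show ?thesis by blast
qed

lemma aligned_withI:
  assumes "\<forall>\<^sub>F i in F. Q i \<noteq> 0" "\<kappa> \<noteq> 0"
    and "\<And>j. ((\<lambda>i. V i $ j / Q i) \<longlongrightarrow> \<kappa> * e $ j) F"
  shows "aligned_with F V e"
  unfolding aligned_with_def
proof (intro exI conjI)
  \<comment> \<open>The normalizing factor must be nonzero at every index, while \<open>Q\<close> is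
    nonzero only eventually; the value 1 fills the gaps.\<close>
  let ?c = "\<lambda>i. if Q i = 0 then 1 else 1 / (\<kappa> * Q i)"
  show "\<forall>i. ?c i \<noteq> 0" using assms(2) by simp
  show "((\<lambda>i. ?c i *s V i) \<longlongrightarrow> e) F"
  proof (rule vec_tendstoI)
    fix j
    have "((\<lambda>i. (1 / \<kappa>) * (V i $ j / Q i)) \<longlongrightarrow> (1 / \<kappa>) * (\<kappa> * e $ j)) F"
      by (rule tendsto_mult[OF tendsto_const assms(3)])
    then have "((\<lambda>i. (1 / \<kappa>) * (V i $ j / Q i)) \<longlongrightarrow> e $ j) F" using assms(2) by simp
    moreover have "\<forall>\<^sub>F i in F. (1 / \<kappa>) * (V i $ j / Q i) = (?c i *s V i) $ j"
      using assms(1) by eventually_elim simp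
    ultimately show "((\<lambda>i. (?c i *s V i) $ j) \<longlongrightarrow> e $ j) F"
      by (rule Lim_transform_eventually)
  qed
qed

section \<open>Families of waves\<close>

text \<open>All assumptions pass to smaller filters. The exclusion of the inviscid mode is not among
  them, because that mode is analysed on the filter where \<open>l\<close> is at most of the order of \<open>\<xi>\<close>.\<close>

locale wave_family =
  fixes \<alpha> :: real
    and F :: "'i filter"
    and \<epsilon> \<delta> \<nu>h \<nu>3 \<omega> :: "'i \<Rightarrow> real"
    and \<xi> :: "'i \<Rightarrow> real^2"
    and l :: "'i \<Rightarrow> complex"
    and U :: "'i \<Rightarrow> complex^5"
  assumes alpha: "- pi / 2 < \<alpha>" "\<alpha> < pi / 2" "sin \<alpha> \<noteq> 0"
    and pos: "\<And>i. \<epsilon> i > 0" "\<And>i. \<delta> i > 0" "\<And>i. \<nu>h i > 0" "\<And>i. \<nu>3 i > 0"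
    and omega: "\<And>i. \<omega> i \<noteq> 0"
    and small: "(\<delta> \<longlongrightarrow> 0) F" "((\<lambda>i. \<bar>\<omega> i * \<epsilon> i\<bar>) \<longlongrightarrow> 0) F"
    and xi: "(\<lambda>i. norm (\<xi> i)) \<in> o[F](\<lambda>i. sqrt \<bar>\<omega> i / nu_eff \<alpha> (\<nu>h i) (\<nu>3 i)\<bar>)"
    and decay: "\<And>i. Re (l i) > 0"
    and nontrivial: "\<And>i. U i \<noteq> 0"
    and solution: "\<And>i. solves_E \<alpha> (\<epsilon> i) (\<delta> i) (\<nu>h i) (\<nu>3 i)
      (wave_u \<alpha> (\<omega> i) (\<xi> i) (l i) (U i)) (wave_p \<alpha> (\<omega> i) (\<xi> i) (l i) (U i))
      (wave_rho \<alpha> (\<omega> i) (\<xi> i) (l i) (U i))"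
begin

definition k :: "'i \<Rightarrow> complex^3" where
  "k i = wave_vec \<alpha> (\<xi> i) (l i)"

definition s :: "'i \<Rightarrow> complex" where
  "s i = \<i> * \<omega> i * \<epsilon> i"

definition m :: "'i \<Rightarrow> complex" where
  "m i = momentum_symbol (\<epsilon> i) (\<nu>h i) (\<nu>3 i) (\<omega> i) (k i)"

definition V :: "'i \<Rightarrow> complex" where
  "V i = viscous_symbol (\<nu>h i) (\<nu>3 i) (k i)"

definition \<nu> :: "'i \<Rightarrow> real" where
  "\<nu> i = nu_eff \<alpha> (\<nu>h i) (\<nu>3 i)"

lemma cos_pos: "cos \<alpha> > 0"
  using alpha cos_gt_zero_pi by simp

lemma nu_pos: "\<nu> i > 0"
  unfolding \<nu>_def nu_eff_def using alpha(3) pos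
  by (intro add_pos_nonneg) (auto simp: less_imp_le)

text \<open>The two viscosities may vary independently along the family; as \<open>\<alpha>\<close>
  is fixed, each is still controlled by the effective viscosity.\<close>

lemma nu_ratio_le: "\<bar>\<nu>h i / \<nu> i\<bar> \<le> 1 / (sin \<alpha>)\<^sup>2" "\<bar>\<nu>3 i / \<nu> i\<bar> \<le> 1 / (cos \<alpha>)\<^sup>2"
proof -
  have "\<nu>h i * (sin \<alpha>)\<^sup>2 \<le> \<nu> i" "\<nu>3 i * (cos \<alpha>)\<^sup>2 \<le> \<nu> i"
    using pos(3,4)[of i] by (simp_all add: \<nu>_def nu_eff_def less_imp_le)
  then show "\<bar>\<nu>h i / \<nu> i\<bar> \<le> 1 / (sin \<alpha>)\<^sup>2" "\<bar>\<nu>3 i / \<nu> i\<bar> \<le> 1 / (cos \<alpha>)\<^sup>2"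
    using nu_pos[of i] pos(3,4)[of i] alpha(3) cos_pos by (simp_all add: field_simps)
qed

lemma s_nonzero: "s i \<noteq> 0"
  using pos(1)[of i] omega[of i] by (simp add: s_def)

lemma l_nonzero: "l i \<noteq> 0"
  using decay[of i] by auto

lemma s_tendsto: "(s \<longlongrightarrow> 0) F"
  by (rule tendsto_norm_zero_cancel) (use small(2) in \<open>simp add: s_def norm_mult abs_mult\<close>)

lemma delta_tendsto: "((\<lambda>i. complex_of_real ((\<delta> i)\<^sup>2)) \<longlongrightarrow> 0) F"
  using tendsto_power[OF tendsto_of_real[OF small(1), where 'a = complex], of 2] by simp

lemma m_eq: "m i = s i - \<epsilon> i * V i"
  by (simp add: m_def s_def V_def momentum_symbol_def algebra_simps)

text \<open>The square of the assumption \<open>xi\<close>: at wave numbers of order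
  \<open>\<xi>\<close>, viscosity is negligible against the time derivative.\<close>

lemma xi_nu_tendsto: "((\<lambda>i. \<nu> i * (norm (\<xi> i))\<^sup>2 / \<bar>\<omega> i\<bar>) \<longlongrightarrow> 0) F"
proof -
  have "((\<lambda>i. norm (\<xi> i) / sqrt \<bar>\<omega> i / \<nu> i\<bar>) \<longlongrightarrow> 0) F"
    using smalloD_tendsto[OF xi] by (simp add: \<nu>_def)
  from tendsto_power[OF this, of 2] show ?thesis
    using nu_pos less_imp_le[OF nu_pos] by (simp add: power_divide abs_divide mult.commute)
qed

lemmas amplitude = amplitude_equations[OF solution pos(1) pos(2), folded k_def, folded m_def s_def]

lemma u3_eq: "(1 + s i * (\<delta> i)\<^sup>2 * m i) * U i $ 3 = - s i * k i $ 3 * U i $ 4"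
  using amplitude(3,4)[of i] by (simp only: of_real_power) algebra

text \<open>Cramer's rule for the horizontal momentum, kept in product form because
  \<open>1 + m^2\<close> may vanish at some indices.\<close>

lemma u1_eq: "(1 + (m i)\<^sup>2) * U i $ 1 = - (m i * k i $ 1 + k i $ 2) * U i $ 4"
  using amplitude(1,2)[of i] by algebra

lemma u2_eq: "(1 + (m i)\<^sup>2) * U i $ 2 = (k i $ 1 - m i * k i $ 2) * U i $ 4"
  using amplitude(1,2)[of i] by algebra

lemma amplitude_nontrivial: "\<not> (U i $ 1 = 0 \<and> U i $ 2 = 0 \<and> U i $ 3 = 0 \<and> U i $ 4 = 0)"
proof
  assume *: "U i $ 1 = 0 \<and> U i $ 2 = 0 \<and> U i $ 3 = 0 \<and> U i $ 4 = 0"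
  then have "U i $ 5 = 0" using amplitude(3)[of i] by simp
  have "U i $ j = 0" for j
  proof -
    obtain z :: int where z: "j = of_int z" "0 \<le> z" "z < 5" by (cases j) auto
    then have "z = 0 \<or> z = 1 \<or> z = 2 \<or> z = 3 \<or> z = 4" by arith
    then have "j = 0 \<or> j = 1 \<or> j = 2 \<or> j = 3 \<or> j = 4" using z(1) by auto
    \<comment> \<open>Numerals of the index type are taken modulo 5, so the fifth component is the
      one at 0.\<close>
    moreover have "(0::5) = 5" by simp
    ultimately show ?thesis using * \<open>U i $ 5 = 0\<close> by metis
  qed
  then show False using nontrivial[of i] by (simp add: vec_eq_iff)
qed

lemma dispersion:
  "m i * ((k i $ 1)\<^sup>2 + (k i $ 2)\<^sup>2) * (1 + s i * (\<delta> i)\<^sup>2 * m i)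
     + s i * (k i $ 3)\<^sup>2 * (1 + (m i)\<^sup>2) = 0"
  by (rule dispersion_relation[OF amplitude(1,2) u3_eq amplitude(5) amplitude_nontrivial])

text \<open>The quotients \<open>k / norm \<xi>\<close> are bounded, so \<open>xi_nu_tendsto\<close>
  gives \<open>m / s\<close> the limit 1. Dividing the dispersion relation by
  \<open>s * (norm \<xi>)^2\<close> then leaves the Laplace symbol, and \<open>Re l > 0\<close>
  selects the root 1.\<close>

lemma inviscid_mode:
  assumes K: "\<forall>\<^sub>F i in F. cmod (l i) \<le> K * norm (\<xi> i)"
  shows "((\<lambda>i. l i / norm (\<xi> i)) \<longlongrightarrow> 1) F"
proof -
  define h where "h j i = k i $ j / norm (\<xi> i)" for j i
  define B where "B = 1 + K"
  have xi_pos: "\<forall>\<^sub>F i in F. norm (\<xi> i) > 0"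
    using K
  proof eventually_elim
    case (elim i)
    have "0 < cmod (l i)" using l_nonzero by simp
    with elim show ?case by (cases "\<xi> i = 0") auto
  qed
  have h_le: "\<forall>\<^sub>F i in F. cmod (h j i) \<le> B" for j
    using K xi_pos
  proof eventually_elim
    case (elim i)
    have "cmod (k i $ j) \<le> norm (\<xi> i) + cmod (l i)" unfolding k_def by (rule norm_wave_vec_le)
    with elim show ?case by (simp add: h_def norm_divide field_simps B_def)
  qed
  have h2_le: "\<forall>\<^sub>F i in F. cmod ((h j i)\<^sup>2) \<le> B\<^sup>2" for j
    using h_le[of j] by eventually_elim (simp add: norm_power power_mono)
  let ?X = "\<lambda>i. \<nu> i * (norm (\<xi> i))\<^sup>2 / \<bar>\<omega> i\<bar>"
  \<comment> \<open>The viscous symbol divided by \<open>\<nu> * (norm \<xi>)^2\<close>, so that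
    \<open>?X * ?W\<close> is \<open>V / \<bar>\<omega>\<bar>\<close>.\<close>
  let ?W = "\<lambda>i. complex_of_real (\<nu>h i / \<nu> i) * ((h 1 i)\<^sup>2 + (h 2 i)\<^sup>2)
    + complex_of_real (\<nu>3 i / \<nu> i) * (h 3 i)\<^sup>2"
  have W_le: "\<forall>\<^sub>F i in F. cmod (?W i) \<le> 1 / (sin \<alpha>)\<^sup>2 * (B\<^sup>2 + B\<^sup>2) + 1 / (cos \<alpha>)\<^sup>2 * B\<^sup>2"
    using h2_le[of 1] h2_le[of 2] h2_le[of 3]
  proof eventually_elim
    case (elim i)
    have "cmod ((h 1 i)\<^sup>2 + (h 2 i)\<^sup>2) \<le> B\<^sup>2 + B\<^sup>2"
      by (rule norm_triangle_le) (use elim in simp)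
    then show ?case
      using elim nu_ratio_le[of i]
      by (intro norm_triangle_le add_mono; unfold norm_mult norm_of_real; intro mult_mono)
        (simp_all del: norm_power)
  qed
  have "((\<lambda>i. complex_of_real (?X i)) \<longlongrightarrow> 0) F"
    using tendsto_of_real[OF xi_nu_tendsto, where 'a = complex] by simp
  from lim_null_mult_right_bounded[OF this W_le]
  have "((\<lambda>i. complex_of_real (?X i) * ?W i) \<longlongrightarrow> 0) F" .
  then have "((\<lambda>i. cmod (complex_of_real (?X i) * ?W i)) \<longlongrightarrow> 0) F"
    by (rule tendsto_norm_zero)
  moreover have "\<forall>\<^sub>F i in F. cmod (complex_of_real (?X i) * ?W i) = cmod (m i / s i - 1)"
    using xi_pos
  proof eventually_elim
    case (elim i)
    have 1: "complex_of_real (?X i) * ?W i = V i / complex_of_real \<bar>\<omega> i\<bar>"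
      using elim nu_pos[of i] omega[of i]
      by (simp add: V_def viscous_symbol_def h_def field_simps)
    have 2: "m i / s i - 1 = - V i / (\<i> * \<omega> i)"
      using s_nonzero[of i] pos(1)[of i] omega[of i] by (simp add: m_eq s_def field_simps)
    show ?case unfolding 1 2 by (simp add: norm_divide norm_mult)
  qed
  ultimately have "((\<lambda>i. cmod (m i / s i - 1)) \<longlongrightarrow> 0) F"
    by (rule Lim_transform_eventually)
  then have ms: "((\<lambda>i. m i / s i) \<longlongrightarrow> 1) F"
    by (simp add: tendsto_norm_zero_iff LIM_zero_iff)
  have "((\<lambda>i. m i / s i * s i) \<longlongrightarrow> 1 * 0) F"
    by (intro tendsto_mult ms s_tendsto)
  then have m0: "(m \<longlongrightarrow> 0) F" using s_nonzero by simp
  have c1: "((\<lambda>i. 1 - m i / s i * (1 + s i * (\<delta> i)\<^sup>2 * m i)) \<longlongrightarrow> 0) F"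
    using tendsto_diff[OF tendsto_const tendsto_mult[OF ms tendsto_add[OF tendsto_const
        tendsto_mult[OF tendsto_mult[OF s_tendsto delta_tendsto] m0]]], of 1 1]
    by simp
  have c2: "((\<lambda>i. (m i)\<^sup>2) \<longlongrightarrow> 0) F"
    using tendsto_power[OF m0, of 2] by simp
  have b: "\<forall>\<^sub>F i in F. cmod ((h 1 i)\<^sup>2 + (h 2 i)\<^sup>2) \<le> B\<^sup>2 + B\<^sup>2"
    using h2_le[of 1] h2_le[of 2]
    by eventually_elim (rule norm_triangle_le, simp)
  \<comment> \<open>This is \<open>(l / norm \<xi>)^2\<close>, obtained by subtracting the scaled
    dispersion relation from \<open>sum_wave_vec_squares\<close>, and written so that each
    correction is a null factor times a bounded one.\<close>
  have "((\<lambda>i. 1 + ((1 - m i / s i * (1 + s i * (\<delta> i)\<^sup>2 * m i)) * ((h 1 i)\<^sup>2 + (h 2 i)\<^sup>2)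
    - (m i)\<^sup>2 * (h 3 i)\<^sup>2)) \<longlongrightarrow> 1 + (0 - 0)) F"
    by (intro tendsto_add tendsto_diff tendsto_const lim_null_mult_right_bounded[OF c1 b]
        lim_null_mult_right_bounded[OF c2 h2_le])
  moreover have "\<forall>\<^sub>F i in F. 1 + ((1 - m i / s i * (1 + s i * (\<delta> i)\<^sup>2 * m i)) * ((h 1 i)\<^sup>2 + (h 2 i)\<^sup>2)
    - (m i)\<^sup>2 * (h 3 i)\<^sup>2) = (l i / norm (\<xi> i))\<^sup>2"
    using xi_pos
  proof eventually_elim
    case (elim i)
    define n where "n = complex_of_real (norm (\<xi> i))"
    have n: "n \<noteq> 0" using elim by (simp add: n_def)
    have kh: "k i $ j = n * h j i" for j using n by (simp add: h_def n_def)
    have lw: "l i = n * (l i / n)" using n by simp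
    have "(k i $ 1)\<^sup>2 + (k i $ 2)\<^sup>2 + (k i $ 3)\<^sup>2 = (l i)\<^sup>2 - n\<^sup>2"
      unfolding k_def sum_wave_vec_squares by (simp add: n_def)
    then have 1: "(h 1 i)\<^sup>2 + (h 2 i)\<^sup>2 + (h 3 i)\<^sup>2 = (l i / n)\<^sup>2 - 1"
      unfolding kh using n lw by algebra
    have ms: "m i = s i * (m i / s i)" using s_nonzero by simp
    have 2: "m i / s i * ((h 1 i)\<^sup>2 + (h 2 i)\<^sup>2) * (1 + s i * (\<delta> i)\<^sup>2 * m i)
        + (h 3 i)\<^sup>2 * (1 + (m i)\<^sup>2) = 0"
      using dispersion[of i] n s_nonzero[of i] ms unfolding kh by algebra
    show ?case unfolding n_def[symmetric] using 1 2 by algebra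
  qed
  ultimately have "((\<lambda>i. (l i / norm (\<xi> i))\<^sup>2) \<longlongrightarrow> 1) F"
    by (rule Lim_transform_eventually[THEN tendsto_eq_rhs]) simp
  \<comment> \<open>Where \<open>\<xi> i = 0\<close> the quotient is 0 by convention and the bound
    still holds.\<close>
  moreover have "1 \<le> cmod (l i / norm (\<xi> i) + 1)" for i
    using complex_Re_le_cmod[of "l i / norm (\<xi> i) + 1"] 
      divide_nonneg_nonneg[OF less_imp_le[OF decay[of i]] norm_ge_zero[of "\<xi> i"]] by simp
  then have "\<forall>\<^sub>F i in F. 1 \<le> cmod (l i / norm (\<xi> i) + 1)" by simp
  ultimately show ?thesis
    by (rule tendsto_1_if_square[OF _ zero_less_one])
qed

lemma subfilter:
  assumes "F' \<le> F"
  shows "wave_family \<alpha> F' \<epsilon> \<delta> \<nu>h \<nu>3 \<omega> \<xi> l U"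
  by unfold_locales
    (use alpha pos omega decay nontrivial solution tendsto_mono[OF assms] small landau_o.small.filter_mono[OF assms xi] in blast)+

text \<open>For each \<open>e\<close> the filter is restricted to the indices where the ratio is at
  least \<open>e\<close>. There \<open>inviscid_mode\<close> applies and contradicts the hypothesis,
  so the restricted filter is trivial, which means that these indices are eventually
  avoided.\<close>

lemma xi_negligible:
  assumes "avoids_inviscid_mode F \<xi> l"
  shows "((\<lambda>i. norm (\<xi> i) / cmod (l i)) \<longlongrightarrow> 0) F"
proof (rule order_tendstoI)
  fix e :: real
  show "\<forall>\<^sub>F i in F. e < norm (\<xi> i) / cmod (l i)" if "e < 0"
    using that by (intro always_eventually allI) (smt (verit) divide_nonneg_nonneg norm_ge_zero)
  assume e: "e > 0"
  define S where "S = {i. cmod (l i) \<le> 1 / e * norm (\<xi> i)}"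
  define F' where "F' = inf F (principal S)"
  have le: "F' \<le> F" by (simp add: F'_def)
  have S: "\<forall>\<^sub>F i in F'. cmod (l i) \<le> 1 / e * norm (\<xi> i)"
    by (simp add: F'_def eventually_inf_principal S_def)
  have lim: "((\<lambda>i. l i / norm (\<xi> i)) \<longlongrightarrow> 1) F'"
    by (rule wave_family.inviscid_mode[OF subfilter[OF le] S])
  obtain c where c: "c > 0" "\<forall>\<^sub>F i in F. c * norm (\<xi> i) \<le> cmod (l i - complex_of_real (norm (\<xi> i)))"
    using assms unfolding avoids_inviscid_mode_def by blast
  have "\<forall>\<^sub>F i in F'. False"
    using tendstoD[OF lim c(1)] filter_leD[OF le c(2)] S
  proof eventually_elim
    case (elim i)
    have n: "norm (\<xi> i) > 0" using elim(3) l_nonzero[of i] by (cases "\<xi> i = 0") auto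
    have "l i - complex_of_real (norm (\<xi> i)) = norm (\<xi> i) * (l i / norm (\<xi> i) - 1)"
      using n by (simp add: field_simps)
    then have "cmod (l i - complex_of_real (norm (\<xi> i))) = norm (\<xi> i) * dist (l i / norm (\<xi> i)) 1"
      by (simp only: norm_mult dist_norm) simp
    also have "\<dots> < norm (\<xi> i) * c" using elim(1) n by simp
    finally show False using elim(2) by (simp add: mult.commute)
  qed
  then have "\<forall>\<^sub>F i in F. i \<notin> S" by (simp add: F'_def eventually_inf_principal)
  then show "\<forall>\<^sub>F i in F. norm (\<xi> i) / cmod (l i) < e"
    by eventually_elim (use e l_nonzero in \<open>simp add: S_def field_simps\<close>)
qed

end

text \<open>A limit 1 of the quotient \<open>f / g\<close> would force \<open>g\<close> to be
  eventually nonzero; the factored form puts no condition on the zeros of \<open>g\<close>.\<close>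

lemma asymp_equivI_factor:
  fixes f g h :: "'i \<Rightarrow> 'a::real_normed_field"
  assumes "(h \<longlongrightarrow> 1) F" "\<And>i. f i = h i * g i"
  shows "f \<sim>[F] g"
proof -
  have "h \<sim>[F] (\<lambda>_. 1)" using assms(1) by (intro asymp_equivI') simp
  from asymp_equiv_mult[OF this asymp_equiv_refl[of g F]] show ?thesis
    by (simp add: assms(2)[abs_def])
qed

section \<open>Wave vectors asymptotically normal to the boundary\<close>

locale viscous_family = wave_family +
  assumes xi_l: "((\<lambda>i. norm (\<xi> i) / cmod (l i)) \<longlongrightarrow> 0) F"
begin

definition a where "a i = k i $ 1 / l i"
definition b where "b i = k i $ 2 / l i"
definition c where "c i = k i $ 3 / l i"

lemma xi_nth_l_tendsto: "((\<lambda>i. \<i> * complex_of_real (\<xi> i $ j) / l i) \<longlongrightarrow> 0) F"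
proof (rule Lim_null_comparison[OF always_eventually xi_l], rule allI)
  fix i
  show "cmod (\<i> * complex_of_real (\<xi> i $ j) / l i) \<le> norm (\<xi> i) / cmod (l i)"
    using component_le_norm_cart[of "\<xi> i" j]
    by (simp add: norm_mult norm_divide divide_right_mono)
qed

lemma a_tendsto: "(a \<longlongrightarrow> complex_of_real (sin \<alpha>)) F"
proof -
  have "a = (\<lambda>i. \<i> * \<xi> i $ 1 / l i * cos \<alpha> + sin \<alpha>)"
    using l_nonzero by (auto simp: fun_eq_iff a_def k_def wave_vec_nth field_simps)
  then show ?thesis
    using tendsto_add[OF tendsto_mult_left_zero[OF xi_nth_l_tendsto[of 1]] tendsto_const] by simp
qed

lemma b_tendsto: "(b \<longlongrightarrow> 0) F"
  using xi_nth_l_tendsto[of 2] by (simp add: b_def[abs_def] k_def wave_vec_nth)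

lemma c_tendsto: "(c \<longlongrightarrow> - complex_of_real (cos \<alpha>)) F"
proof -
  have "c = (\<lambda>i. \<i> * \<xi> i $ 1 / l i * sin \<alpha> + - complex_of_real (cos \<alpha>))"
    using l_nonzero by (auto simp: fun_eq_iff c_def k_def wave_vec_nth field_simps)
  then show ?thesis
    using tendsto_add[OF tendsto_mult_left_zero[OF xi_nth_l_tendsto[of 1]]
        tendsto_const[of "- complex_of_real (cos \<alpha>)"]] by simp
qed

lemma k_eq: "k i $ 1 = a i * l i" "k i $ 2 = b i * l i" "k i $ 3 = c i * l i"
  using l_nonzero by (simp_all add: a_def b_def c_def)

text \<open>The effective viscosity is the viscous symbol at the unit normal \<open>e_z\<close>, the
  limiting direction of the wave vector. Since the ratios of \<open>\<nu>h\<close> and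
  \<open>\<nu>3\<close> to \<open>\<nu>\<close> need not converge, the error is arranged as null
  factors times these bounded ratios.\<close>

lemma V_tendsto: "((\<lambda>i. V i / (\<nu> i * (l i)\<^sup>2)) \<longlongrightarrow> 1) F"
proof -
  have ab: "((\<lambda>i. (a i)\<^sup>2 + (b i)\<^sup>2 - (complex_of_real (sin \<alpha>))\<^sup>2) \<longlongrightarrow> 0) F"
    using tendsto_diff[OF tendsto_add[OF tendsto_power[OF a_tendsto, of 2] tendsto_power[OF b_tendsto, of 2]]
        tendsto_const[of "(complex_of_real (sin \<alpha>))\<^sup>2"]] by simp
  have c: "((\<lambda>i. (c i)\<^sup>2 - (complex_of_real (cos \<alpha>))\<^sup>2) \<longlongrightarrow> 0) F"
    using tendsto_diff[OF tendsto_power[OF c_tendsto, of 2]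
        tendsto_const[of "(complex_of_real (cos \<alpha>))\<^sup>2"]] by simp
  have r: "\<forall>\<^sub>F i in F. cmod (complex_of_real (\<nu>h i / \<nu> i)) \<le> 1 / (sin \<alpha>)\<^sup>2"
    "\<forall>\<^sub>F i in F. cmod (complex_of_real (\<nu>3 i / \<nu> i)) \<le> 1 / (cos \<alpha>)\<^sup>2"
    unfolding norm_of_real using nu_ratio_le by (auto simp del: abs_divide)
  have "((\<lambda>i. 1 + (((a i)\<^sup>2 + (b i)\<^sup>2 - (complex_of_real (sin \<alpha>))\<^sup>2) * complex_of_real (\<nu>h i / \<nu> i)
     + ((c i)\<^sup>2 - (complex_of_real (cos \<alpha>))\<^sup>2) * complex_of_real (\<nu>3 i / \<nu> i))) \<longlongrightarrow> 1 + (0 + 0)) F"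
    by (intro tendsto_add tendsto_const lim_null_mult_right_bounded[OF ab r(1)]
        lim_null_mult_right_bounded[OF c r(2)])
  moreover have "1 + (((a i)\<^sup>2 + (b i)\<^sup>2 - (complex_of_real (sin \<alpha>))\<^sup>2) * complex_of_real (\<nu>h i / \<nu> i)
     + ((c i)\<^sup>2 - (complex_of_real (cos \<alpha>))\<^sup>2) * complex_of_real (\<nu>3 i / \<nu> i)) = V i / (\<nu> i * (l i)\<^sup>2)" for i
  proof -
    have n: "complex_of_real (\<nu> i) \<noteq> 0" "l i \<noteq> 0" using nu_pos[of i] l_nonzero by auto
    have nu: "complex_of_real (\<nu> i) = \<nu>h i * (complex_of_real (sin \<alpha>))\<^sup>2 + \<nu>3 i * (complex_of_real (cos \<alpha>))\<^sup>2"
      by (simp add: \<nu>_def nu_eff_def)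
    have V: "V i = (\<nu>h i * ((a i)\<^sup>2 + (b i)\<^sup>2) + \<nu>3 i * (c i)\<^sup>2) * (l i)\<^sup>2"
      unfolding V_def viscous_symbol_def k_eq by algebra
    have "(\<nu> i) + (((a i)\<^sup>2 + (b i)\<^sup>2 - (complex_of_real (sin \<alpha>))\<^sup>2) * \<nu>h i
        + ((c i)\<^sup>2 - (complex_of_real (cos \<alpha>))\<^sup>2) * \<nu>3 i)
      = \<nu>h i * ((a i)\<^sup>2 + (b i)\<^sup>2) + \<nu>3 i * (c i)\<^sup>2" (is "?n + (?x * ?y + ?z * ?w) = ?r")
      unfolding nu by algebra
    moreover have "1 + (?x * (?y / ?n) + ?z * (?w / ?n)) = (?n + (?x * ?y + ?z * ?w)) / ?n"
      by (simp only: add_divide_distrib times_divide_eq_right divide_self[OF n(1)])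
    ultimately show ?thesis unfolding V using n by simp
  qed
  ultimately show ?thesis by simp
qed

lemma dispersion_scaled:
  "m i * ((a i)\<^sup>2 + (b i)\<^sup>2) * (1 + s i * (\<delta> i)\<^sup>2 * m i) + s i * (c i)\<^sup>2 * (1 + (m i)\<^sup>2) = 0"
  using dispersion[of i] l_nonzero[of i] unfolding k_eq by algebra

text \<open>Inserting \<open>U $ 3 = s * U $ 5\<close> into the vertical momentum equation gives
  hydrostatic balance exactly, up to the factor \<open>1 + s * \<delta>^2 * m\<close> that carries
  vertical acceleration and viscosity.\<close>

lemma hydrostatic:
  assumes "((\<lambda>i. s i * complex_of_real ((\<delta> i)\<^sup>2) * m i) \<longlongrightarrow> 0) F"
  shows "hydrostatic_balance \<alpha> F (\<lambda>i. wave_p \<alpha> (\<omega> i) (\<xi> i) (l i) (U i))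
    (\<lambda>i. wave_rho \<alpha> (\<omega> i) (\<xi> i) (l i) (U i))"
  unfolding hydrostatic_balance_def partial_wave_p
proof (intro allI impI asymp_equivI_factor)
  show "((\<lambda>i. 1 + s i * complex_of_real ((\<delta> i)\<^sup>2) * m i) \<longlongrightarrow> 1) F"
    using tendsto_add[OF tendsto_const assms, of 1] by simp
  fix t :: "'a \<Rightarrow> real" and x :: "'a \<Rightarrow> real^3" and i
  have "k i $ 3 * U i $ 4 = - (1 + s i * complex_of_real ((\<delta> i)\<^sup>2) * m i) * U i $ 5"
    using amplitude(3,4)[of i] by algebra
  then show "wave_vec \<alpha> (\<xi> i) (l i) $ 3 * wave_p \<alpha> (\<omega> i) (\<xi> i) (l i) (U i) (t i) (x i) =
      (1 + s i * complex_of_real ((\<delta> i)\<^sup>2) * m i) * - wave_rho \<alpha> (\<omega> i) (\<xi> i) (l i) (U i) (t i) (x i)"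
    unfolding wave_p_def wave_rho_def k_def[symmetric] by algebra
qed

lemma alignment:
  assumes Q: "\<forall>\<^sub>F i in F. Q i \<noteq> 0" and "\<kappa> \<noteq> 0"
    and "((\<lambda>i. U i $ 1 / Q i) \<longlongrightarrow> \<kappa> * complex_of_real (v $ 1)) F"
    "((\<lambda>i. U i $ 2 / Q i) \<longlongrightarrow> \<kappa> * complex_of_real (v $ 2)) F"
    "((\<lambda>i. U i $ 3 / Q i) \<longlongrightarrow> \<kappa> * complex_of_real (v $ 3)) F"
  shows "aligned_with F (\<lambda>i. velocity_part (U i)) (cvec v)"
proof (rule aligned_withI[OF Q \<open>\<kappa> \<noteq> 0\<close>])
  have "\<forall>j. ((\<lambda>i. velocity_part (U i) $ j / Q i) \<longlongrightarrow> \<kappa> * cvec v $ j) F"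
    unfolding forall_3 using assms(3-5) by (simp add: velocity_part_def cvec_def)
  then show "((\<lambda>i. velocity_part (U i) $ j / Q i) \<longlongrightarrow> \<kappa> * cvec v $ j) F" for j by blast
qed

end

section \<open>The small root\<close>

locale slow_family = viscous_family +
  assumes m_le: "\<forall>\<^sub>F i in F. cmod (m i) \<le> 1"
begin

text \<open>The dispersion relation regroups as \<open>m * f = - c^2 * s\<close>. Boundedness of
  \<open>m\<close> makes \<open>s * m\<close> vanish, so \<open>f\<close> tends to the square of
  \<open>sin \<alpha>\<close>.\<close>

lemma m_over_s_tendsto: "((\<lambda>i. m i / s i) \<longlongrightarrow> - (complex_of_real (cos \<alpha>))\<^sup>2 / (complex_of_real (sin \<alpha>))\<^sup>2) F"
proof -
  define f where "f i = ((a i)\<^sup>2 + (b i)\<^sup>2)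
    + (complex_of_real ((\<delta> i)\<^sup>2) * ((a i)\<^sup>2 + (b i)\<^sup>2) + (c i)\<^sup>2) * (s i * m i)" for i
  have sm: "((\<lambda>i. s i * m i) \<longlongrightarrow> 0) F"
    by (rule lim_null_mult_right_bounded[OF s_tendsto m_le])
  have f: "(f \<longlongrightarrow> (complex_of_real (sin \<alpha>))\<^sup>2) F"
    unfolding f_def
    by (rule tendsto_eq_rhs, (rule tendsto_add tendsto_mult tendsto_power a_tendsto b_tendsto c_tendsto
        delta_tendsto sm)+) simp
  have "(complex_of_real (sin \<alpha>))\<^sup>2 \<noteq> 0" using alpha(3) by simp
  then have f0: "\<forall>\<^sub>F i in F. f i \<noteq> 0" by (rule tendsto_imp_eventually_ne[OF f])
  have "((\<lambda>i. - (c i)\<^sup>2 / f i) \<longlongrightarrow> - (- complex_of_real (cos \<alpha>))\<^sup>2 / (complex_of_real (sin \<alpha>))\<^sup>2) F"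
    by (intro tendsto_divide tendsto_minus tendsto_power c_tendsto f) (use alpha(3) in simp)
  moreover have "\<forall>\<^sub>F i in F. - (c i)\<^sup>2 / f i = m i / s i"
    using f0
  proof eventually_elim
    case (elim i)
    have "m i * f i = - (c i)\<^sup>2 * s i" using dispersion_scaled[of i] unfolding f_def by algebra
    then show ?case using elim s_nonzero[of i] by (simp add: field_simps)
  qed
  ultimately show ?thesis by (rule Lim_transform_eventually[THEN tendsto_eq_rhs]) simp
qed

lemma m_tendsto: "(m \<longlongrightarrow> 0) F"
  using tendsto_mult[OF m_over_s_tendsto s_tendsto] s_nonzero by simp

text \<open>Here \<open>V / (\<i> * \<omega>) = 1 - m / s\<close> tends to
  \<open>1 / (sin \<alpha>)^2\<close>, while \<open>V\<close> is asymptotically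
  \<open>\<nu> * l^2\<close>. This fixes \<open>l^2\<close>.\<close>

lemma rate: "l \<sim>[F] (\<lambda>i. rate2 \<alpha> (\<nu>h i) (\<nu>3 i) (\<omega> i))"
proof (rule asymp_equiv_if_square)
  let ?S = "complex_of_real (sin \<alpha>)" and ?C = "complex_of_real (cos \<alpha>)"
  have S: "?S \<noteq> 0" using alpha(3) by simp
  have SC: "?S\<^sup>2 + ?C\<^sup>2 = 1"
    by (metis of_real_1 of_real_add of_real_power sin_cos_squared_add)
  have "((\<lambda>i. (1 - m i / s i) / (V i / (\<nu> i * (l i)\<^sup>2)) * ?S\<^sup>2) \<longlongrightarrow> (1 - - ?C\<^sup>2 / ?S\<^sup>2) / 1 * ?S\<^sup>2) F"
    by (intro tendsto_mult tendsto_divide tendsto_diff tendsto_const m_over_s_tendsto V_tendsto) simp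
  also have "(1 - - ?C\<^sup>2 / ?S\<^sup>2) / 1 * ?S\<^sup>2 = 1"
    using S SC by (simp add: field_simps)
  finally have lim: "((\<lambda>i. (1 - m i / s i) / (V i / (\<nu> i * (l i)\<^sup>2)) * ?S\<^sup>2) \<longlongrightarrow> 1) F" .
  have "\<forall>\<^sub>F i in F. V i / (\<nu> i * (l i)\<^sup>2) \<noteq> 0"
    using tendsto_imp_eventually_ne[OF V_tendsto, of 0] by simp
  then have "\<forall>\<^sub>F i in F. (1 - m i / s i) / (V i / (\<nu> i * (l i)\<^sup>2)) * ?S\<^sup>2
     = (l i)\<^sup>2 / (rate2 \<alpha> (\<nu>h i) (\<nu>3 i) (\<omega> i))\<^sup>2"
  proof eventually_elim
    case (elim i)
    have r: "(rate2 \<alpha> (\<nu>h i) (\<nu>3 i) (\<omega> i))\<^sup>2 = \<i> * \<omega> i / (\<nu> i * ?S\<^sup>2)"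
    proof -
      have "(rate2 \<alpha> (\<nu>h i) (\<nu>3 i) (\<omega> i))\<^sup>2 = (exp (\<i> * complex_of_real (pi / 4 * sgn (\<omega> i))))\<^sup>2
          * complex_of_real ((sqrt \<bar>\<omega> i\<bar> / (sqrt (\<nu> i) * \<bar>sin \<alpha>\<bar>))\<^sup>2)"
        by (simp only: rate2_def power_mult_distrib of_real_power \<nu>_def)
      also have "(sqrt \<bar>\<omega> i\<bar> / (sqrt (\<nu> i) * \<bar>sin \<alpha>\<bar>))\<^sup>2 = \<bar>\<omega> i\<bar> / (\<nu> i * (sin \<alpha>)\<^sup>2)"
        using nu_pos[of i] by (simp add: power_divide power_mult_distrib)
      finally show ?thesis
        using exp_quarter_turn_squared(1)[OF omega[of i]] by simp
    qed
    have V: "\<epsilon> i * V i = s i - m i" by (simp add: m_eq)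
    have "V i \<noteq> 0" using elim by auto
    have e: "complex_of_real (\<epsilon> i) \<noteq> 0" using pos(1)[of i] by simp
    have ms: "1 - m i / s i = V i / (\<i> * \<omega> i)"
    proof -
      have "1 - m i / s i = (s i - m i) / s i" using s_nonzero[of i] by (simp add: diff_divide_distrib)
      then show ?thesis unfolding V[symmetric] using e by (simp add: s_def)
    qed
    show ?case unfolding r ms
      using \<open>V i \<noteq> 0\<close> nu_pos[of i] l_nonzero[of i] omega[of i] S by (simp add: field_simps)
  qed
  from Lim_transform_eventually[OF lim this]
  show "((\<lambda>i. (l i)\<^sup>2 / (rate2 \<alpha> (\<nu>h i) (\<nu>3 i) (\<omega> i))\<^sup>2) \<longlongrightarrow> 1) F" .
  show "rate2 \<alpha> (\<nu>h i) (\<nu>3 i) (\<omega> i) = exp (\<i> * complex_of_real (pi / 4 * sgn (\<omega> i)))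
      * complex_of_real (sqrt \<bar>\<omega> i\<bar> / (sqrt (\<nu> i) * \<bar>sin \<alpha>\<bar>))" for i
    by (simp add: rate2_def \<nu>_def)
  show "sqrt \<bar>\<omega> i\<bar> / (sqrt (\<nu> i) * \<bar>sin \<alpha>\<bar>) > 0" for i
    using nu_pos[of i] omega[of i] alpha(3) by simp
  show "\<bar>pi / 4 * sgn (\<omega> i)\<bar> = pi / 4" for i
    using omega[of i] by (simp add: abs_mult abs_sgn_eq)
  show "Re (l i) > 0" for i by (rule decay)
qed

text \<open>The scale of the pressure gradient, hence of a geostrophically balanced
  velocity.\<close>

definition Q where "Q i = l i * U i $ 4"

lemma s_delta_m_tendsto: "((\<lambda>i. s i * complex_of_real ((\<delta> i)\<^sup>2) * m i) \<longlongrightarrow> 0) F"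
  using tendsto_mult[OF tendsto_mult[OF s_tendsto delta_tendsto] m_tendsto] by simp

lemma eventually_regular:
  "\<forall>\<^sub>F i in F. 1 + (m i)\<^sup>2 \<noteq> 0" "\<forall>\<^sub>F i in F. 1 + s i * (\<delta> i)\<^sup>2 * m i \<noteq> 0"
proof -
  have "((\<lambda>i. 1 + (m i)\<^sup>2) \<longlongrightarrow> 1) F" "((\<lambda>i. 1 + s i * (\<delta> i)\<^sup>2 * m i) \<longlongrightarrow> 1) F"
    using tendsto_add[OF tendsto_const tendsto_power[OF m_tendsto, of 2], of 1]
      tendsto_add[OF tendsto_const s_delta_m_tendsto, of 1] by simp_all
  from this[THEN tendsto_imp_eventually_ne, of 0]
  show "\<forall>\<^sub>F i in F. 1 + (m i)\<^sup>2 \<noteq> 0" "\<forall>\<^sub>F i in F. 1 + s i * (\<delta> i)\<^sup>2 * m i \<noteq> 0" by simp_all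
qed

text \<open>Without pressure, the solved amplitude equations would force the whole velocity to
  vanish once their coefficients are nonzero.\<close>

lemma Q_nonzero: "\<forall>\<^sub>F i in F. Q i \<noteq> 0"
  using eventually_regular
proof eventually_elim
  case (elim i)
  show ?case
  proof
    assume "Q i = 0"
    then have "U i $ 4 = 0" using l_nonzero by (simp add: Q_def)
    then show False using u1_eq[of i] u2_eq[of i] u3_eq[of i] elim amplitude_nontrivial[of i] by auto
  qed
qed

text \<open>In units of \<open>Q\<close> the solved amplitudes depend only on \<open>m\<close>,
  \<open>s\<close>, \<open>\<delta>\<close>, \<open>a\<close>, \<open>b\<close>, \<open>c\<close>;
  with \<open>m\<close>, \<open>s\<close> and \<open>b\<close> tending to 0, only the term
  \<open>a\<close> in the second component survives.\<close>

lemma u_tendsto: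
  "((\<lambda>i. U i $ 1 / Q i) \<longlongrightarrow> 0) F"
  "((\<lambda>i. U i $ 2 / Q i) \<longlongrightarrow> complex_of_real (sin \<alpha>)) F"
  "((\<lambda>i. U i $ 3 / Q i) \<longlongrightarrow> 0) F"
proof -
  have d1: "((\<lambda>i. 1 + (m i)\<^sup>2) \<longlongrightarrow> 1 + 0\<^sup>2) F"
    by (intro tendsto_intros m_tendsto)
  have d2: "((\<lambda>i. 1 + s i * complex_of_real ((\<delta> i)\<^sup>2) * m i) \<longlongrightarrow> 1 + 0) F"
    by (intro tendsto_add tendsto_const s_delta_m_tendsto)
  have "((\<lambda>i. - (m i * a i + b i) / (1 + (m i)\<^sup>2)) \<longlongrightarrow> - (0 * complex_of_real (sin \<alpha>) + 0) / (1 + 0\<^sup>2)) F"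
    by (intro tendsto_divide d1 tendsto_minus tendsto_add tendsto_mult m_tendsto a_tendsto b_tendsto) simp
  moreover have "\<forall>\<^sub>F i in F. - (m i * a i + b i) / (1 + (m i)\<^sup>2) = U i $ 1 / Q i"
    using eventually_regular(1) Q_nonzero
  proof eventually_elim
    case (elim i)
    have "(1 + (m i)\<^sup>2) * U i $ 1 = - (m i * a i + b i) * Q i"
      using u1_eq[of i] unfolding k_eq Q_def by algebra
    then show ?case unfolding frac_eq_eq[OF elim] by (simp only: mult.commute)
  qed
  ultimately show "((\<lambda>i. U i $ 1 / Q i) \<longlongrightarrow> 0) F" 
    by (rule Lim_transform_eventually[THEN tendsto_eq_rhs]) simp
  have "((\<lambda>i. (a i - m i * b i) / (1 + (m i)\<^sup>2)) \<longlongrightarrow> (complex_of_real (sin \<alpha>) - 0 * 0) / (1 + 0\<^sup>2)) F"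
    by (intro tendsto_divide d1 tendsto_diff tendsto_mult m_tendsto a_tendsto b_tendsto) simp
  moreover have "\<forall>\<^sub>F i in F. (a i - m i * b i) / (1 + (m i)\<^sup>2) = U i $ 2 / Q i"
    using eventually_regular(1) Q_nonzero
  proof eventually_elim
    case (elim i)
    have "(1 + (m i)\<^sup>2) * U i $ 2 = (a i - m i * b i) * Q i"
      using u2_eq[of i] unfolding k_eq Q_def by algebra
    then show ?case unfolding frac_eq_eq[OF elim] by (simp only: mult.commute)
  qed
  ultimately show "((\<lambda>i. U i $ 2 / Q i) \<longlongrightarrow> complex_of_real (sin \<alpha>)) F" 
    by (rule Lim_transform_eventually[THEN tendsto_eq_rhs]) simp
  have "((\<lambda>i. - s i * c i / (1 + s i * complex_of_real ((\<delta> i)\<^sup>2) * m i)) \<longlongrightarrow>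
      - 0 * - complex_of_real (cos \<alpha>) / (1 + 0)) F"
    by (intro tendsto_divide d2 tendsto_mult tendsto_minus s_tendsto c_tendsto) simp
  moreover have "\<forall>\<^sub>F i in F. - s i * c i / (1 + s i * complex_of_real ((\<delta> i)\<^sup>2) * m i) = U i $ 3 / Q i"
    using eventually_regular(2) Q_nonzero
  proof eventually_elim
    case (elim i)
    have "(1 + s i * complex_of_real ((\<delta> i)\<^sup>2) * m i) * U i $ 3 = - s i * c i * Q i"
      using u3_eq[of i] unfolding k_eq Q_def by algebra
    then show ?case unfolding frac_eq_eq[OF elim] by (simp only: mult.commute)
  qed
  ultimately show "((\<lambda>i. U i $ 3 / Q i) \<longlongrightarrow> 0) F" 
    by (rule Lim_transform_eventually[THEN tendsto_eq_rhs]) simp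
qed

lemma aligned: "aligned_with F (\<lambda>i. velocity_part (U i)) (cvec e_y)"
  by (rule alignment[OF Q_nonzero, where \<kappa> = "complex_of_real (sin \<alpha>)"])
    (use alpha(3) u_tendsto in \<open>simp_all add: e_y_def\<close>)

text \<open>The residual of the balance is exactly \<open>- m\<close> times the horizontal velocity,
  and the pressure gradient is at least \<open>\<bar>a * Q\<bar>\<close>. The exponential is a
  common factor, so times and points may vary freely with the index.\<close>

lemma quasi_geostrophic:
  "quasi_geostrophic_balance \<alpha> F (\<lambda>i. wave_u \<alpha> (\<omega> i) (\<xi> i) (l i) (U i))
     (\<lambda>i. wave_p \<alpha> (\<omega> i) (\<xi> i) (l i) (U i))"
  unfolding quasi_geostrophic_balance_def Let_def partial_wave_p
proof (intro allI impI landau_o.smallI)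
  fix t :: "'a \<Rightarrow> real" and x :: "'a \<Rightarrow> real^3" and r :: real
  assume r: "r > 0"
  let ?u = "\<lambda>i. wave_u \<alpha> (\<omega> i) (\<xi> i) (l i) (U i) (t i) (x i)"
  let ?p = "\<lambda>i. wave_p \<alpha> (\<omega> i) (\<xi> i) (l i) (U i) (t i) (x i)"
  let ?uperp = "\<lambda>i. vector [- ?u i $ 2, ?u i $ 1] :: complex^2"
  let ?grad = "\<lambda>i. vector [wave_vec \<alpha> (\<xi> i) (l i) $ 1 * ?p i, wave_vec \<alpha> (\<xi> i) (l i) $ 2 * ?p i] :: complex^2"
  let ?E = "\<lambda>i. plane_wave \<alpha> (\<omega> i) (\<xi> i) (l i) (t i) (x i)"
  have "((\<lambda>i. cmod (m i) * (cmod (U i $ 1 / Q i) + cmod (U i $ 2 / Q i)) / cmod (a i))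
      \<longlongrightarrow> cmod 0 * (cmod 0 + cmod (complex_of_real (sin \<alpha>))) / cmod (complex_of_real (sin \<alpha>))) F"
    by (intro tendsto_divide tendsto_mult tendsto_add tendsto_norm m_tendsto u_tendsto a_tendsto)
      (use alpha(3) in simp)
  then have "\<forall>\<^sub>F i in F. cmod (m i) * (cmod (U i $ 1 / Q i) + cmod (U i $ 2 / Q i)) / cmod (a i) < r"
    using r by (intro order_tendstoD(2)) simp
  moreover have "\<forall>\<^sub>F i in F. a i \<noteq> 0"
    by (rule tendsto_imp_eventually_ne[OF a_tendsto]) (use alpha(3) in simp)
  ultimately show "\<forall>\<^sub>F i in F. norm (norm (?uperp i - - ?grad i)) \<le> r * norm (norm (?grad i))"
    using Q_nonzero
  proof eventually_elim
    case (elim i)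
    have "cmod (m i) * (cmod (U i $ 1) + cmod (U i $ 2)) \<le> r * cmod (a i * Q i)"
      using elim by (simp add: norm_divide norm_mult field_simps)
    then have *: "cmod (?E i) * (cmod (m i) * (cmod (U i $ 1) + cmod (U i $ 2))) \<le> cmod (?E i) * (r * cmod (a i * Q i))"
      by (rule mult_left_mono) simp
    have 1: "(?uperp i - - ?grad i) $ 1 = - (?E i * m i * U i $ 1)"
      using amplitude(1)[of i]
      by (simp add: wave_u_def wave_p_def velocity_part_def k_def[symmetric]) algebra
    have 2: "(?uperp i - - ?grad i) $ 2 = - (?E i * m i * U i $ 2)"
      using amplitude(2)[of i]
      by (simp add: wave_u_def wave_p_def velocity_part_def k_def[symmetric]) algebra
    have "norm (?uperp i - - ?grad i) \<le> (\<Sum>j\<in>UNIV. cmod ((?uperp i - - ?grad i) $ j))"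
      unfolding norm_vec_def by (rule L2_set_le_sum) simp
    also have "\<dots> = cmod (?E i) * (cmod (m i) * (cmod (U i $ 1) + cmod (U i $ 2)))"
      unfolding sum_2 1 2 by (simp add: norm_mult algebra_simps)
    also note *
    also have "cmod (?E i) * (r * cmod (a i * Q i)) = r * cmod (?grad i $ 1)"
      by (simp add: wave_p_def k_def[symmetric] k_eq Q_def norm_mult)
    also have "\<dots> \<le> r * norm (?grad i)"
      using r by (intro mult_left_mono Finite_Cartesian_Product.norm_nth_le) simp
    finally show ?case by simp
  qed
qed

end

section \<open>The large root\<close>

locale fast_family = viscous_family +
  assumes m_ge: "\<forall>\<^sub>F i in F. cmod (m i) \<ge> 1"
begin

lemma m_nonzero: "\<forall>\<^sub>F i in F. m i \<noteq> 0"
  using m_ge by eventually_elim auto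

text \<open>Divide the dispersion relation by \<open>m\<close>: the bound on \<open>1 / m\<close>
  makes \<open>s / m\<close> vanish, and what remains is linear in \<open>s * m\<close>.\<close>

lemma s_m_tendsto: "((\<lambda>i. s i * m i) \<longlongrightarrow> - (complex_of_real (sin \<alpha>))\<^sup>2 / (complex_of_real (cos \<alpha>))\<^sup>2) F"
proof -
  have "\<forall>\<^sub>F i in F. cmod (1 / m i) \<le> 1"
    using m_ge by eventually_elim (simp add: norm_divide divide_le_eq_1)
  then have s_over_m: "((\<lambda>i. s i * (1 / m i)) \<longlongrightarrow> 0) F"
    by (rule lim_null_mult_right_bounded[OF s_tendsto])
  define f where "f i = complex_of_real ((\<delta> i)\<^sup>2) * ((a i)\<^sup>2 + (b i)\<^sup>2) + (c i)\<^sup>2" for i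
  have f: "(f \<longlongrightarrow> (complex_of_real (cos \<alpha>))\<^sup>2) F"
    unfolding f_def
    by (rule tendsto_eq_rhs, (rule tendsto_add tendsto_mult tendsto_power a_tendsto b_tendsto c_tendsto
        delta_tendsto)+) simp
  have "(complex_of_real (cos \<alpha>))\<^sup>2 \<noteq> 0" using cos_pos by simp
  then have f0: "\<forall>\<^sub>F i in F. f i \<noteq> 0" by (rule tendsto_imp_eventually_ne[OF f])
  have "((\<lambda>i. - ((a i)\<^sup>2 + (b i)\<^sup>2 + s i * (1 / m i) * (c i)\<^sup>2) / f i) \<longlongrightarrow>
      - ((complex_of_real (sin \<alpha>))\<^sup>2 + 0\<^sup>2 + 0 * (- complex_of_real (cos \<alpha>))\<^sup>2) / (complex_of_real (cos \<alpha>))\<^sup>2) F"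
    by (intro tendsto_divide tendsto_minus tendsto_add tendsto_mult tendsto_power
        a_tendsto b_tendsto c_tendsto s_over_m f) (use cos_pos in simp)
  moreover have "\<forall>\<^sub>F i in F. - ((a i)\<^sup>2 + (b i)\<^sup>2 + s i * (1 / m i) * (c i)\<^sup>2) / f i = s i * m i"
    using f0 m_nonzero
  proof eventually_elim
    case (elim i)
    define r where "r = 1 / m i"
    have r: "m i * r = 1" using elim by (simp add: r_def)
    have "s i * m i * f i = - ((a i)\<^sup>2 + (b i)\<^sup>2 + s i * r * (c i)\<^sup>2)"
      using dispersion_scaled[of i] r unfolding f_def by algebra
    then show ?case using elim unfolding r_def[symmetric] by (simp add: divide_eq_eq)
  qed
  ultimately show ?thesis by (rule Lim_transform_eventually[THEN tendsto_eq_rhs]) simp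
qed

text \<open>The lower bound 1 on \<open>m\<close> improves to divergence, since \<open>s\<close>
  tends to 0 while \<open>s * m\<close> has a nonzero limit.\<close>

lemma inverse_m_tendsto: "((\<lambda>i. 1 / m i) \<longlongrightarrow> 0) F"
proof -
  have "((\<lambda>i. s i / (s i * m i)) \<longlongrightarrow> 0 / (- (complex_of_real (sin \<alpha>))\<^sup>2 / (complex_of_real (cos \<alpha>))\<^sup>2)) F"
    by (intro tendsto_divide s_tendsto s_m_tendsto) (use alpha(3) cos_pos in simp)
  then show ?thesis using s_nonzero by simp
qed

lemma s_delta_m_tendsto: "((\<lambda>i. s i * complex_of_real ((\<delta> i)\<^sup>2) * m i) \<longlongrightarrow> 0) F"
  using tendsto_mult[OF delta_tendsto s_m_tendsto] by (simp add: mult_ac)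

text \<open>Multiply \<open>s - m = \<epsilon> * V\<close> by \<open>s\<close>: the term
  \<open>s^2\<close> disappears and \<open>V\<close> may be replaced by
  \<open>\<nu> * l^2\<close>.\<close>

lemma l_squared_tendsto:
  "((\<lambda>i. s i * \<epsilon> i * \<nu> i * (l i)\<^sup>2) \<longlongrightarrow> (complex_of_real (sin \<alpha>))\<^sup>2 / (complex_of_real (cos \<alpha>))\<^sup>2) F"
proof -
  have "((\<lambda>i. (s i * s i - s i * m i) / (V i / (\<nu> i * (l i)\<^sup>2))) \<longlongrightarrow>
      (0 * 0 - - (complex_of_real (sin \<alpha>))\<^sup>2 / (complex_of_real (cos \<alpha>))\<^sup>2) / 1) F"
    by (intro tendsto_divide tendsto_diff tendsto_mult s_tendsto s_m_tendsto V_tendsto) simp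
  moreover have "\<forall>\<^sub>F i in F. V i / (\<nu> i * (l i)\<^sup>2) \<noteq> 0"
    using tendsto_imp_eventually_ne[OF V_tendsto, of 0] by simp
  then have "\<forall>\<^sub>F i in F. (s i * s i - s i * m i) / (V i / (\<nu> i * (l i)\<^sup>2)) = s i * \<epsilon> i * \<nu> i * (l i)\<^sup>2"
  proof eventually_elim
    case (elim i)
    have eq: "s i * s i - s i * m i = s i * \<epsilon> i * V i" unfolding m_eq by algebra
    have "V i \<noteq> 0" using elim by auto
    then show ?case unfolding eq by simp
  qed
  ultimately show ?thesis by (rule Lim_transform_eventually[THEN tendsto_eq_rhs]) simp
qed

lemma rate: "l \<sim>[F] (\<lambda>i. rate1 \<alpha> (\<epsilon> i) (\<nu>h i) (\<nu>3 i) (\<omega> i))"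
proof (rule asymp_equiv_if_square)
  let ?R = "\<lambda>i. \<bar>tan \<alpha>\<bar> / (sqrt (\<nu> i) * \<epsilon> i * sqrt \<bar>\<omega> i\<bar>)"
  have tan: "tan \<alpha> \<noteq> 0" using alpha(3) cos_pos by (simp add: tan_def)
  have "((\<lambda>i. s i * \<epsilon> i * \<nu> i * (l i)\<^sup>2 / (complex_of_real (tan \<alpha>))\<^sup>2) \<longlongrightarrow>
      (complex_of_real (sin \<alpha>))\<^sup>2 / (complex_of_real (cos \<alpha>))\<^sup>2 / (complex_of_real (tan \<alpha>))\<^sup>2) F"
    by (intro tendsto_divide l_squared_tendsto tendsto_const) (use tan in simp)
  also have "(complex_of_real (sin \<alpha>))\<^sup>2 / (complex_of_real (cos \<alpha>))\<^sup>2 / (complex_of_real (tan \<alpha>))\<^sup>2 = 1"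
    using alpha(3) cos_pos by (simp add: tan_def power_divide)
  finally have lim: "((\<lambda>i. s i * \<epsilon> i * \<nu> i * (l i)\<^sup>2 / (complex_of_real (tan \<alpha>))\<^sup>2) \<longlongrightarrow> 1) F" .
  have "s i * \<epsilon> i * \<nu> i * (l i)\<^sup>2 / (complex_of_real (tan \<alpha>))\<^sup>2
     = (l i)\<^sup>2 / (rate1 \<alpha> (\<epsilon> i) (\<nu>h i) (\<nu>3 i) (\<omega> i))\<^sup>2" for i
  proof -
    \<comment> \<open>The squared phase turns \<open>\<bar>\<omega>\<bar>\<close> in the denominator
      into \<open>e * (\<i> * \<omega>)\<close>, after which \<open>e\<close> cancels.\<close>
    define e where "e = (exp (- \<i> * complex_of_real (pi / 4 * sgn (\<omega> i))))\<^sup>2"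
    have e: "e * (\<i> * \<omega> i) = complex_of_real \<bar>\<omega> i\<bar>"
      unfolding e_def by (rule exp_quarter_turn_squared(2)[OF omega])
    have "(?R i)\<^sup>2 = (tan \<alpha>)\<^sup>2 / (\<nu> i * (\<epsilon> i)\<^sup>2 * \<bar>\<omega> i\<bar>)"
      using nu_pos[of i] by (simp add: power_divide power_mult_distrib)
    then have "(rate1 \<alpha> (\<epsilon> i) (\<nu>h i) (\<nu>3 i) (\<omega> i))\<^sup>2
        = e * complex_of_real ((tan \<alpha>)\<^sup>2 / (\<nu> i * (\<epsilon> i)\<^sup>2 * \<bar>\<omega> i\<bar>))"
      by (simp only: rate1_def power_mult_distrib \<nu>_def e_def of_real_power[symmetric])
    also have "\<dots> = e * (complex_of_real (tan \<alpha>))\<^sup>2 / (\<nu> i * (\<epsilon> i)\<^sup>2 * (e * (\<i> * \<omega> i)))"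
      unfolding e by simp
    also have "\<dots> = (complex_of_real (tan \<alpha>))\<^sup>2 / (\<nu> i * (\<epsilon> i)\<^sup>2 * (\<i> * \<omega> i))"
      by (simp add: e_def)
    finally have r: "(rate1 \<alpha> (\<epsilon> i) (\<nu>h i) (\<nu>3 i) (\<omega> i))\<^sup>2
      = (complex_of_real (tan \<alpha>))\<^sup>2 / (\<nu> i * (\<epsilon> i)\<^sup>2 * (\<i> * \<omega> i))" .
    show ?thesis unfolding r s_def by (simp add: power2_eq_square mult_ac)
  qed
  with lim show "((\<lambda>i. (l i)\<^sup>2 / (rate1 \<alpha> (\<epsilon> i) (\<nu>h i) (\<nu>3 i) (\<omega> i))\<^sup>2) \<longlongrightarrow> 1) F" by simp
  show "rate1 \<alpha> (\<epsilon> i) (\<nu>h i) (\<nu>3 i) (\<omega> i)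
      = exp (\<i> * complex_of_real (- (pi / 4 * sgn (\<omega> i)))) * complex_of_real (?R i)" for i
    by (simp add: rate1_def \<nu>_def)
  show "?R i > 0" for i
    using nu_pos[of i] pos(1)[of i] omega[of i] tan by simp
  show "\<bar>- (pi / 4 * sgn (\<omega> i))\<bar> = pi / 4" for i
    using omega[of i] by (simp add: abs_mult abs_sgn_eq)
  show "Re (l i) > 0" for i by (rule decay)
qed

text \<open>Although \<open>m\<close> is large, \<open>m b\<close> is small: its square is a bounded multiple of
  \<open>\<nu> \<xi>\<^sub>y\<^sup>2 / \<omega>\<close>, which is where \<open>|\<xi>| \<lless> |\<omega> / \<nu>\<^sub>e\<^sub>f\<^sub>f|\<^sup>1\<^sup>/\<^sup>2\<close> enters.\<close>

lemma m_b_tendsto: "((\<lambda>i. m i * b i) \<longlongrightarrow> 0) F"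
proof -
  have "((\<lambda>i. \<nu> i * (complex_of_real (\<xi> i $ 2))\<^sup>2 / (\<i> * \<omega> i)) \<longlongrightarrow> 0) F"
  proof (rule Lim_null_comparison[OF always_eventually xi_nu_tendsto], rule allI)
    fix i
    have "\<bar>\<xi> i $ 2\<bar>\<^sup>2 \<le> (norm (\<xi> i))\<^sup>2"
      by (intro power_mono component_le_norm_cart) simp
    then show "cmod (\<nu> i * (complex_of_real (\<xi> i $ 2))\<^sup>2 / (\<i> * \<omega> i)) \<le> \<nu> i * (norm (\<xi> i))\<^sup>2 / \<bar>\<omega> i\<bar>"
      using nu_pos[of i] by (simp add: norm_divide norm_mult norm_power divide_right_mono)
  qed
  then have "((\<lambda>i. - ((s i * m i)\<^sup>2 * (\<nu> i * (complex_of_real (\<xi> i $ 2))\<^sup>2 / (\<i> * \<omega> i)) / (s i * \<epsilon> i * \<nu> i * (l i)\<^sup>2)))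
    \<longlongrightarrow> - ((- (complex_of_real (sin \<alpha>))\<^sup>2 / (complex_of_real (cos \<alpha>))\<^sup>2)\<^sup>2 * 0 /
      ((complex_of_real (sin \<alpha>))\<^sup>2 / (complex_of_real (cos \<alpha>))\<^sup>2))) F"
    by (intro tendsto_minus tendsto_divide tendsto_mult tendsto_power s_m_tendsto l_squared_tendsto)
      (use alpha(3) cos_pos in simp_all)
  moreover have "- ((s i * m i)\<^sup>2 * (\<nu> i * (complex_of_real (\<xi> i $ 2))\<^sup>2 / (\<i> * \<omega> i)) / (s i * \<epsilon> i * \<nu> i * (l i)\<^sup>2))
    = (m i * b i)\<^sup>2" for i
    using nu_pos[of i] pos(1)[of i] omega[of i] l_nonzero[of i]
    by (simp add: b_def k_def wave_vec_nth s_def power2_eq_square mult_ac)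
  ultimately have "((\<lambda>i. (m i * b i)\<^sup>2) \<longlongrightarrow> 0) F" by simp
  then have "((\<lambda>i. sqrt (cmod ((m i * b i)\<^sup>2))) \<longlongrightarrow> sqrt 0) F"
    by (intro tendsto_real_sqrt tendsto_norm_zero)
  then show ?thesis
    by (simp only: norm_power real_sqrt_abs abs_norm_cancel real_sqrt_zero tendsto_norm_zero_iff)
qed

text \<open>For large \<open>m\<close> the first momentum row is dominated by
  \<open>m * U $ 1\<close> against the pressure gradient, which gives this velocity scale.\<close>

definition P where "P i = l i * U i $ 4 / m i"

lemma eventually_regular:
  "\<forall>\<^sub>F i in F. 1 + (1 / m i)\<^sup>2 \<noteq> 0" "\<forall>\<^sub>F i in F. 1 + s i * (\<delta> i)\<^sup>2 * m i \<noteq> 0"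
proof -
  have "((\<lambda>i. 1 + (1 / m i)\<^sup>2) \<longlongrightarrow> 1) F" "((\<lambda>i. 1 + s i * (\<delta> i)\<^sup>2 * m i) \<longlongrightarrow> 1) F"
    using tendsto_add[OF tendsto_const tendsto_power[OF inverse_m_tendsto, of 2], of 1]
      tendsto_add[OF tendsto_const s_delta_m_tendsto, of 1] by simp_all
  from this[THEN tendsto_imp_eventually_ne, of 0]
  show "\<forall>\<^sub>F i in F. 1 + (1 / m i)\<^sup>2 \<noteq> 0" "\<forall>\<^sub>F i in F. 1 + s i * (\<delta> i)\<^sup>2 * m i \<noteq> 0" by simp_all
qed

text \<open>Cramer's formulas divided by \<open>m^2\<close>, with bounded coefficients. The second
  is multiplied by \<open>m\<close>, because \<open>U $ 2\<close> is smaller by that factor but its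
  product with \<open>m\<close> enters the viscous balance.\<close>

lemma u_P_eq:
  assumes "m i \<noteq> 0"
  shows "(1 + (1 / m i)\<^sup>2) * U i $ 1 = - (a i + 1 / m i * b i) * P i"
    and "(1 + (1 / m i)\<^sup>2) * (m i * U i $ 2) = (a i - m i * b i) * P i"
    and "(1 + s i * complex_of_real ((\<delta> i)\<^sup>2) * m i) * U i $ 3 = - (s i * m i) * c i * P i"
proof -
  define r where "r = 1 / m i"
  have r: "m i * r = 1" "P i = l i * U i $ 4 * r" using assms by (simp_all add: r_def P_def)
  show "(1 + (1 / m i)\<^sup>2) * U i $ 1 = - (a i + 1 / m i * b i) * P i"
    using u1_eq[of i] unfolding k_eq r_def[symmetric] r(2) using r(1) by algebra
  show "(1 + (1 / m i)\<^sup>2) * (m i * U i $ 2) = (a i - m i * b i) * P i"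
    using u2_eq[of i] unfolding k_eq r_def[symmetric] r(2) using r(1) by algebra
  show "(1 + s i * complex_of_real ((\<delta> i)\<^sup>2) * m i) * U i $ 3 = - (s i * m i) * c i * P i"
    using u3_eq[of i] unfolding k_eq r(2) using r(1) by algebra
qed

lemma P_nonzero: "\<forall>\<^sub>F i in F. P i \<noteq> 0"
  using eventually_regular m_nonzero
proof eventually_elim
  case (elim i)
  show ?case
  proof
    assume P: "P i = 0"
    then have "U i $ 4 = 0" using l_nonzero elim by (simp add: P_def)
    then show False using u_P_eq[OF elim(3)] P elim amplitude_nontrivial[of i]
      by (simp del: of_real_power)
  qed
qed

text \<open>The first and third limits are \<open>- tan \<alpha>\<close> times
  \<open>cos \<alpha>\<close> and \<open>sin \<alpha>\<close>, the direction \<open>e_x\<close>. The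
  second limit rests on \<open>m_b_tendsto\<close>.\<close>

lemma u_tendsto:
  "((\<lambda>i. U i $ 1 / P i) \<longlongrightarrow> - complex_of_real (sin \<alpha>)) F"
  "((\<lambda>i. m i * U i $ 2 / P i) \<longlongrightarrow> complex_of_real (sin \<alpha>)) F"
  "((\<lambda>i. U i $ 3 / P i) \<longlongrightarrow> - (complex_of_real (sin \<alpha>))\<^sup>2 / complex_of_real (cos \<alpha>)) F"
proof -
  have d1: "((\<lambda>i. 1 + (1 / m i)\<^sup>2) \<longlongrightarrow> 1 + 0\<^sup>2) F"
    by (intro tendsto_add tendsto_const tendsto_power inverse_m_tendsto)
  have d2: "((\<lambda>i. 1 + s i * complex_of_real ((\<delta> i)\<^sup>2) * m i) \<longlongrightarrow> 1 + 0) F"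
    by (intro tendsto_add tendsto_const s_delta_m_tendsto)
  have "((\<lambda>i. - (a i + 1 / m i * b i) / (1 + (1 / m i)\<^sup>2)) \<longlongrightarrow> - (complex_of_real (sin \<alpha>) + 0 * 0) / (1 + 0\<^sup>2)) F"
    by (intro tendsto_divide[OF _ d1] tendsto_minus tendsto_add tendsto_mult inverse_m_tendsto a_tendsto b_tendsto) simp
  moreover have "\<forall>\<^sub>F i in F. - (a i + 1 / m i * b i) / (1 + (1 / m i)\<^sup>2) = U i $ 1 / P i"
    using eventually_regular(1) P_nonzero m_nonzero
  proof eventually_elim
    case (elim i)
    show ?case unfolding frac_eq_eq[OF elim(1,2)] using u_P_eq(1)[OF elim(3)] by (simp only: mult.commute)
  qed
  ultimately show "((\<lambda>i. U i $ 1 / P i) \<longlongrightarrow> - complex_of_real (sin \<alpha>)) F"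
    by (rule Lim_transform_eventually[THEN tendsto_eq_rhs]) simp
  have "((\<lambda>i. (a i - m i * b i) / (1 + (1 / m i)\<^sup>2)) \<longlongrightarrow> (complex_of_real (sin \<alpha>) - 0) / (1 + 0\<^sup>2)) F"
    by (intro tendsto_divide[OF _ d1] tendsto_diff m_b_tendsto a_tendsto) simp
  moreover have "\<forall>\<^sub>F i in F. (a i - m i * b i) / (1 + (1 / m i)\<^sup>2) = m i * U i $ 2 / P i"
    using eventually_regular(1) P_nonzero m_nonzero
  proof eventually_elim
    case (elim i)
    show ?case unfolding frac_eq_eq[OF elim(1,2)] using u_P_eq(2)[OF elim(3)] by (simp only: mult.commute)
  qed
  ultimately show "((\<lambda>i. m i * U i $ 2 / P i) \<longlongrightarrow> complex_of_real (sin \<alpha>)) F"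
    by (rule Lim_transform_eventually[THEN tendsto_eq_rhs]) simp
  have "((\<lambda>i. - (s i * m i) * c i / (1 + s i * complex_of_real ((\<delta> i)\<^sup>2) * m i)) \<longlongrightarrow>
      - (- (complex_of_real (sin \<alpha>))\<^sup>2 / (complex_of_real (cos \<alpha>))\<^sup>2) * - complex_of_real (cos \<alpha>) / (1 + 0)) F"
    by (intro tendsto_divide[OF _ d2] tendsto_mult tendsto_minus s_m_tendsto c_tendsto) simp
  moreover have "\<forall>\<^sub>F i in F. - (s i * m i) * c i / (1 + s i * complex_of_real ((\<delta> i)\<^sup>2) * m i) = U i $ 3 / P i"
    using eventually_regular(2) P_nonzero m_nonzero
  proof eventually_elim
    case (elim i)
    show ?case unfolding frac_eq_eq[OF elim(1,2)] using u_P_eq(3)[OF elim(3)] by (simp only: mult.commute)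
  qed
  ultimately show "((\<lambda>i. U i $ 3 / P i) \<longlongrightarrow> - (complex_of_real (sin \<alpha>))\<^sup>2 / complex_of_real (cos \<alpha>)) F"
    by (rule Lim_transform_eventually[THEN tendsto_eq_rhs]) (use cos_pos in \<open>simp add: power2_eq_square\<close>)
qed

lemma u2_tendsto: "((\<lambda>i. U i $ 2 / P i) \<longlongrightarrow> 0) F"
proof -
  have "((\<lambda>i. 1 / m i * (m i * U i $ 2 / P i)) \<longlongrightarrow> 0 * complex_of_real (sin \<alpha>)) F"
    by (intro tendsto_mult inverse_m_tendsto u_tendsto)
  moreover have "\<forall>\<^sub>F i in F. 1 / m i * (m i * U i $ 2 / P i) = U i $ 2 / P i"
    using m_nonzero by eventually_elim simp
  ultimately show ?thesis by (rule Lim_transform_eventually[THEN tendsto_eq_rhs]) simp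
qed

lemma aligned: "aligned_with F (\<lambda>i. velocity_part (U i)) (cvec (e_x \<alpha>))"
  by (rule alignment[OF P_nonzero, where \<kappa> = "- complex_of_real (sin \<alpha>) / complex_of_real (cos \<alpha>)"])
    (use alpha(3) cos_pos u_tendsto u2_tendsto in \<open>simp_all add: e_x_def power2_eq_square\<close>)

lemma u1_nonzero: "\<forall>\<^sub>F i in F. U i $ 1 \<noteq> 0"
proof -
  have "\<forall>\<^sub>F i in F. U i $ 1 / P i \<noteq> 0"
    by (rule tendsto_imp_eventually_ne[OF u_tendsto(1)]) (use alpha(3) in simp)
  then show ?thesis by eventually_elim auto
qed

text \<open>Relative to the Coriolis term, up to sign, viscosity is
  \<open>(s - m) * U $ 2 / U $ 1\<close>, the time derivative \<open>s * U $ 2 / U $ 1\<close> and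
  the pressure \<open>m * b / (U $ 1 / P)\<close>. Their limits are 1, 0 and 0.\<close>

lemma rotation_balance:
  "rotation_balances_viscosity_y \<alpha> F \<epsilon> \<delta> \<nu>h \<nu>3 (\<lambda>i. wave_u \<alpha> (\<omega> i) (\<xi> i) (l i) (U i))
     (\<lambda>i. wave_p \<alpha> (\<omega> i) (\<xi> i) (l i) (U i))"
  unfolding rotation_balances_viscosity_y_def Let_def
proof (intro allI impI conjI)
  fix t :: "'a \<Rightarrow> real" and x :: "'a \<Rightarrow> real^3"
  let ?u = "\<lambda>i. wave_u \<alpha> (\<omega> i) (\<xi> i) (l i) (U i)"
  let ?p = "\<lambda>i. wave_p \<alpha> (\<omega> i) (\<xi> i) (l i) (U i)"
  let ?E = "\<lambda>i. plane_wave \<alpha> (\<omega> i) (\<xi> i) (l i) (t i) (x i)"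
  have C: "coriolis_term (\<epsilon> i) (?u i (t i) (x i)) $ 2 = ?E i * U i $ 1 / \<epsilon> i" for i
    by (simp add: coriolis_term_def wave_u_def velocity_part_def scaleR_conv_of_real[of _ "_::complex"])
  have E: "?E i \<noteq> 0" "\<epsilon> i \<noteq> 0" for i
    using pos(1)[of i] by (simp_all add: plane_wave_nonzero)
  have C0: "\<forall>\<^sub>F i in F. ?E i * U i $ 1 / \<epsilon> i \<noteq> 0"
    using u1_nonzero by eventually_elim (simp add: E)
  have vis: "viscous_term (\<nu>h i) (\<nu>3 i) (?u i (t i)) (x i) $ 2 = - V i * ?E i * U i $ 2" for i
    by (simp add: viscous_term_wave V_def k_def wave_u_def velocity_part_def)
  show "(\<lambda>i. viscous_term (\<nu>h i) (\<nu>3 i) (?u i (t i)) (x i) $ 2) \<sim>[F]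
      (\<lambda>i. - coriolis_term (\<epsilon> i) (?u i (t i) (x i)) $ 2)"
    unfolding C vis
  proof (rule asymp_equivI')
    have "((\<lambda>i. (s i * (1 / m i) - 1) * (m i * U i $ 2 / P i) / (U i $ 1 / P i)) \<longlongrightarrow>
      (0 * 0 - 1) * complex_of_real (sin \<alpha>) / (- complex_of_real (sin \<alpha>))) F"
      by (intro tendsto_divide tendsto_mult tendsto_diff tendsto_const s_tendsto inverse_m_tendsto u_tendsto)
        (use alpha(3) in simp)
    moreover have "\<forall>\<^sub>F i in F. (s i * (1 / m i) - 1) * (m i * U i $ 2 / P i) / (U i $ 1 / P i)
       = (- V i * ?E i * U i $ 2) / (- (?E i * U i $ 1 / \<epsilon> i))"
      using m_nonzero P_nonzero u1_nonzero
    proof eventually_elim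
      case (elim i)
      have "(s i * (1 / m i) - 1) * (m i * U i $ 2 / P i) / (U i $ 1 / P i) = (s i - m i) * U i $ 2 / U i $ 1"
        using elim by (simp add: field_simps)
      also have "\<dots> = \<epsilon> i * V i * U i $ 2 / U i $ 1" by (simp add: m_eq)
      also have "\<dots> = (- V i * ?E i * U i $ 2) / (- (?E i * U i $ 1 / \<epsilon> i))"
        using elim E[of i] by simp
      finally show ?case .
    qed
    ultimately show "((\<lambda>i. (- V i * ?E i * U i $ 2) / (- (?E i * U i $ 1 / \<epsilon> i))) \<longlongrightarrow> 1) F"
      by (rule Lim_transform_eventually[THEN tendsto_eq_rhs]) (use alpha(3) in simp)
  qed
  have dt: "dt (?u i) (t i) (x i) $ 2 = \<i> * \<omega> i * ?E i * U i $ 2" for i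
    by (simp add: dt_wave wave_u_def velocity_part_def)
  show "(\<lambda>i. dt (?u i) (t i) (x i) $ 2) \<in> o[F](\<lambda>i. coriolis_term (\<epsilon> i) (?u i (t i) (x i)) $ 2)"
    unfolding C dt
  proof (rule smalloI_tendsto[OF _ C0])
    have "((\<lambda>i. s i * (U i $ 2 / P i) / (U i $ 1 / P i)) \<longlongrightarrow> 0 * 0 / - complex_of_real (sin \<alpha>)) F"
      by (intro tendsto_divide tendsto_mult s_tendsto u2_tendsto u_tendsto) (use alpha(3) in simp)
    moreover have "\<forall>\<^sub>F i in F. s i * (U i $ 2 / P i) / (U i $ 1 / P i)
       = (\<i> * \<omega> i * ?E i * U i $ 2) / (?E i * U i $ 1 / \<epsilon> i)"
      using P_nonzero u1_nonzero
      by eventually_elim (use E in \<open>simp add: s_def mult_ac\<close>)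
    ultimately show "((\<lambda>i. (\<i> * \<omega> i * ?E i * U i $ 2) / (?E i * U i $ 1 / \<epsilon> i)) \<longlongrightarrow> 0) F"
      by (rule Lim_transform_eventually[THEN tendsto_eq_rhs]) simp
  qed
  have pr: "pressure_term (\<epsilon> i) (\<delta> i) (?p i (t i)) (x i) $ 2 = b i * l i * U i $ 4 * ?E i / \<epsilon> i" for i
    by (simp add: pressure_term_def partial_wave_p wave_p_def k_def[symmetric] k_eq(2)
        scaleR_conv_of_real[of _ "_::complex"] mult_ac)
  show "(\<lambda>i. pressure_term (\<epsilon> i) (\<delta> i) (?p i (t i)) (x i) $ 2)
      \<in> o[F](\<lambda>i. coriolis_term (\<epsilon> i) (?u i (t i) (x i)) $ 2)"
    unfolding C pr
  proof (rule smalloI_tendsto[OF _ C0])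
    have "((\<lambda>i. m i * b i / (U i $ 1 / P i)) \<longlongrightarrow> 0 / - complex_of_real (sin \<alpha>)) F"
      by (intro tendsto_divide m_b_tendsto u_tendsto) (use alpha(3) in simp)
    moreover have "\<forall>\<^sub>F i in F. m i * b i / (U i $ 1 / P i)
       = (b i * l i * U i $ 4 * ?E i / \<epsilon> i) / (?E i * U i $ 1 / \<epsilon> i)"
      using m_nonzero u1_nonzero
      by eventually_elim (use E in \<open>simp add: P_def mult_ac\<close>)
    ultimately show "((\<lambda>i. (b i * l i * U i $ 4 * ?E i / \<epsilon> i) / (?E i * U i $ 1 / \<epsilon> i)) \<longlongrightarrow> 0) F"
      by (rule Lim_transform_eventually[THEN tendsto_eq_rhs]) simp
  qed
qed

end

section \<open>Splitting the family between the two roots\<close>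

theorem proposition5p1:
  fixes \<alpha> :: real
    and F :: "'i filter"
    and \<epsilon> \<delta> \<nu>h \<nu>3 \<omega> :: "'i \<Rightarrow> real"
    and \<xi> :: "'i \<Rightarrow> real^2"
    and l :: "'i \<Rightarrow> complex"
    and U :: "'i \<Rightarrow> complex^5"
  defines "u \<equiv> \<lambda>i. wave_u \<alpha> (\<omega> i) (\<xi> i) (l i) (U i)"
    and "p \<equiv> \<lambda>i. wave_p \<alpha> (\<omega> i) (\<xi> i) (l i) (U i)"
    and "\<rho> \<equiv> \<lambda>i. wave_rho \<alpha> (\<omega> i) (\<xi> i) (l i) (U i)"
  assumes alpha: "- pi / 2 < \<alpha>" "\<alpha> < pi / 2" "sin \<alpha> \<noteq> 0"
    and pos: "\<And>i. \<epsilon> i > 0" "\<And>i. \<delta> i > 0" "\<And>i. \<nu>h i > 0" "\<And>i. \<nu>3 i > 0"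
    and omega: "\<And>i. \<omega> i \<noteq> 0"
    and small: "(\<epsilon> \<longlongrightarrow> 0) F" "(\<delta> \<longlongrightarrow> 0) F" "((\<lambda>i. \<bar>\<omega> i * \<epsilon> i\<bar>) \<longlongrightarrow> 0) F"
    and xi: "(\<lambda>i. norm (\<xi> i)) \<in> o[F](\<lambda>i. sqrt \<bar>\<omega> i / nu_eff \<alpha> (\<nu>h i) (\<nu>3 i)\<bar>)"
    and decay: "\<And>i. Re (l i) > 0" "filterlim (\<lambda>i. Re (l i)) at_top F"
    and inviscid: "avoids_inviscid_mode F \<xi> l"
    and nontrivial: "\<And>i. U i \<noteq> 0"
    and solution: "\<And>i. solves_E \<alpha> (\<epsilon> i) (\<delta> i) (\<nu>h i) (\<nu>3 i) (u i) (p i) (\<rho> i)"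
  shows "\<exists>S :: 'i set. \<exists>F1 F2. F1 = inf F (principal S) \<and> F2 = inf F (principal (- S)) \<and>
     (l \<sim>[F1] (\<lambda>i. rate1 \<alpha> (\<epsilon> i) (\<nu>h i) (\<nu>3 i) (\<omega> i)) \<and>
      aligned_with F1 (\<lambda>i. velocity_part (U i)) (cvec (e_x \<alpha>)) \<and>
      hydrostatic_balance \<alpha> F1 p \<rho> \<and>
      rotation_balances_viscosity_y \<alpha> F1 \<epsilon> \<delta> \<nu>h \<nu>3 u p) \<and>
     (l \<sim>[F2] (\<lambda>i. rate2 \<alpha> (\<nu>h i) (\<nu>3 i) (\<omega> i)) \<and>
      aligned_with F2 (\<lambda>i. velocity_part (U i)) (cvec e_y) \<and>
      hydrostatic_balance \<alpha> F2 p \<rho> \<and>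
      quasi_geostrophic_balance \<alpha> F2 u p)"
proof -
  interpret wave_family \<alpha> F \<epsilon> \<delta> \<nu>h \<nu>3 \<omega> \<xi> l U
    by unfold_locales (use assms in \<open>auto simp: u_def p_def \<rho>_def\<close>)
  \<comment> \<open>A family may alternate between the roots, so the alternative is decided index by
    index. If one of the two filters is trivial, its claims hold vacuously.\<close>
  define S where "S = {i. cmod (m i) \<ge> 1}"
  define F1 where "F1 = inf F (principal S)"
  define F2 where "F2 = inf F (principal (- S))"
  have le: "F1 \<le> F" "F2 \<le> F" by (simp_all add: F1_def F2_def)
  note xi_l = xi_negligible[OF inviscid]
  have "\<forall>\<^sub>F i in F1. cmod (m i) \<ge> 1" "\<forall>\<^sub>F i in F2. cmod (m i) \<le> 1"
    by (simp_all add: F1_def F2_def eventually_inf_principal S_def)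
  then interpret fast: fast_family \<alpha> F1 \<epsilon> \<delta> \<nu>h \<nu>3 \<omega> \<xi> l U + slow: slow_family \<alpha> F2 \<epsilon> \<delta> \<nu>h \<nu>3 \<omega> \<xi> l U
    by (simp_all add: fast_family_def slow_family_def viscous_family_def fast_family_axioms_def
        slow_family_axioms_def viscous_family_axioms_def subfilter le tendsto_mono[OF _ xi_l])
  show ?thesis
  proof (intro exI conjI)
    show "F1 = inf F (principal S)" "F2 = inf F (principal (- S))" by (fact F1_def F2_def)+
    show "l \<sim>[F1] (\<lambda>i. rate1 \<alpha> (\<epsilon> i) (\<nu>h i) (\<nu>3 i) (\<omega> i))" by (rule fast.rate)
    show "aligned_with F1 (\<lambda>i. velocity_part (U i)) (cvec (e_x \<alpha>))" by (rule fast.aligned)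
    show "hydrostatic_balance \<alpha> F1 p \<rho>"
      unfolding p_def \<rho>_def by (rule fast.hydrostatic[OF fast.s_delta_m_tendsto])
    show "rotation_balances_viscosity_y \<alpha> F1 \<epsilon> \<delta> \<nu>h \<nu>3 u p"
      unfolding u_def p_def by (rule fast.rotation_balance)
    show "l \<sim>[F2] (\<lambda>i. rate2 \<alpha> (\<nu>h i) (\<nu>3 i) (\<omega> i))" by (rule slow.rate)
    show "aligned_with F2 (\<lambda>i. velocity_part (U i)) (cvec e_y)" by (rule slow.aligned)
    show "hydrostatic_balance \<alpha> F2 p \<rho>"
      unfolding p_def \<rho>_def by (rule slow.hydrostatic[OF slow.s_delta_m_tendsto])
    show "quasi_geostrophic_balance \<alpha> F2 u p"
      unfolding u_def p_def by (rule slow.quasi_geostrophic)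
  qed
qed

end
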